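(* Let $\Delta$ be of type $D_n$ and let $\mathfrak{Ab}$ be its poset of abelian ideals. Then (i) $\mathcal K^{u}_{\mathfrak{Ab}}(q)=\sum_{k\ge0}\big(\binom{n+2}{2k}-4\binom{n-1}{2k-2}\big)q^k=\sum_{k\ge0}\big(\binom{n}{2k}+\binom{n-1}{2k-1}+\binom{n-2}{2k-1}+\binom{n-2}{2k-4}\big)q^k$; (ii) $\mathcal K^{l}_{\mathfrak{Ab}}(q)=\sum_{k\ge0}\big(\binom{n}{2k+1}+\binom{n}{2k-2}\big)q^k$; (iii) $D_{\mathfrak{Ab}}(q)=-\sum_{k\ge0}\big(\binom{n-2}{2k+1}+\binom{n-3}{2k}\big)q^k$.
   Context: Type $D_n$: positive roots $\Delta^+=\{\varepsilon_i\pm\varepsilon_j:1\le i<j\le n\}$, simple roots $\varepsilon_i-\varepsilon_{i+1}$ ($i<n$), $\varepsilon_{n-1}+\varepsilon_n$, with the root order (generated by $\gamma$ covering $\mu$ iff $\gamma-\mu$ is a simple root). An upper ideal $I\subset\Delta^+$ (up-closed subset) is abelian if $\gamma'+\gamma''\notin\Delta^+$ for all $\gamma',\gamma''\in I$; $\mathfrak{Ab}$ is the poset of all abelian upper ideals (including $\varnothing$) ordered by inclusion. For a finite poset $\mathcal P$, $\kappa(x)$ (resp. $\iota(x)$) is the number of elements covered by (resp. covering) $x$; $\mathcal K^{u}_{\mathcal P}=\sum_x q^{\kappa(x)}$, $\mathcal K^{l}_{\mathcal P}=\sum_x q^{\iota(x)}$, and $D_{\mathcal P}$ is defined by $\mathcal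 K^{u}_{\mathcal P}-\mathcal K^{l}_{\mathcal P}=(q-1)^2D_{\mathcal P}$. Binomial coefficients with negative lower index are $0$. *)

theory Defs
  imports
    "HOL-Library.Function_Algebras"
    "HOL-Computational_Algebra.Computational_Algebra"
begin

text \<open>A finite poset is given as a finite set \<open>P\<close> of elements of an ordered type, with the
  induced order; covering is taken relative to \<open>P\<close>.\<close>

definition covered_in :: "'a::order set \<Rightarrow> 'a \<Rightarrow> 'a \<Rightarrow> bool" where
  "covered_in P x y \<longleftrightarrow> x \<in> P \<and> y \<in> P \<and> x < y \<and> \<not> (\<exists>z\<in>P. x < z \<and> z < y)"

definition kappa :: "'a::order set \<Rightarrow> 'a \<Rightarrow> nat" where
  "kappa P x = card {y \<in> P. covered_in P y x}"

definition iota :: "'a::order set \<Rightarrow> 'a \<Rightarrow> nat" where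
  "iota P x = card {y \<in> P. covered_in P x y}"

definition upper_covering_poly :: "'a::order set \<Rightarrow> int poly" where
  "upper_covering_poly P = (\<Sum>x\<in>P. monom 1 (kappa P x))"

definition lower_covering_poly :: "'a::order set \<Rightarrow> int poly" where
  "lower_covering_poly P = (\<Sum>x\<in>P. monom 1 (iota P x))"

definition deviation_poly :: "'a::order set \<Rightarrow> int poly" where
  "deviation_poly P =
     (THE D. upper_covering_poly P - lower_covering_poly P = [:-1, 1:]\<^sup>2 * D)"

lemma monom_expand_at_1:
  "\<exists>r. monom (1::int) k = 1 + of_nat k * [:-1, 1:] + [:-1, 1:]\<^sup>2 * r"
proof (induction k)
  case 0
  show ?case by (intro exI[of _ 0]) (simp add: monom_0 one_pCons)
next
  case (Suc k)
  let ?t = "[:-1, 1:] :: int poly"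
  from Suc obtain r where r: "monom 1 k = 1 + of_nat k * ?t + ?t\<^sup>2 * r" by blast
  have "monom (1::int) (Suc k) = monom 1 k * (1 + ?t)"
    by (simp add: monom_Suc one_pCons mult.commute)
  also have "\<dots> = 1 + of_nat (Suc k) * ?t + ?t\<^sup>2 * (of_nat k + r * (1 + ?t))"
    unfolding r of_nat_Suc by algebra
  finally show ?case by blast
qed

lemma sum_kappa_eq_sum_iota:
  assumes "finite P"
  shows "(\<Sum>x\<in>P. kappa P x) = (\<Sum>x\<in>P. iota P x)"
proof -
  have "(\<Sum>x\<in>P. kappa P x) = (\<Sum>x\<in>P. \<Sum>y\<in>P. if covered_in P y x then 1 else 0)"
    using assms by (simp add: kappa_def sum.If_cases Int_def)
  also have "\<dots> = (\<Sum>y\<in>P. \<Sum>x\<in>P. if covered_in P y x then 1 else 0)"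
    by (rule sum.swap)
  also have "\<dots> = (\<Sum>x\<in>P. iota P x)"
    using assms by (simp add: iota_def sum.If_cases Int_def)
  finally show ?thesis .
qed

lemma deviation_poly_ex1:
  assumes "finite P"
  shows "\<exists>!D. upper_covering_poly P - lower_covering_poly P = [:-1, 1:]\<^sup>2 * D"
proof -
  let ?t = "[:-1, 1:] :: int poly"
  obtain r where r: "\<And>k. monom (1::int) k = 1 + of_nat k * ?t + ?t\<^sup>2 * r k"
    using monom_expand_at_1 by metis
  have expand: "(\<Sum>x\<in>P. monom 1 (f x)) =
      of_nat (card P) + of_nat (\<Sum>x\<in>P. f x) * ?t + ?t\<^sup>2 * (\<Sum>x\<in>P. r (f x))" for f
    by (subst r) (simp only: sum.distrib sum_distrib_left sum_distrib_right of_nat_sum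
        sum_constant mult_1_right)
  have "upper_covering_poly P - lower_covering_poly P =
      ?t\<^sup>2 * ((\<Sum>x\<in>P. r (kappa P x)) - (\<Sum>x\<in>P. r (iota P x)))"
    unfolding upper_covering_poly_def lower_covering_poly_def expand
      sum_kappa_eq_sum_iota[OF assms] by (simp only: algebra_simps)
  then show ?thesis
    by (auto simp del: mult_pCons_left)
qed

text \<open>Vectors of \<open>\<real>\<^sup>n\<close> are functions \<open>nat \<Rightarrow> real\<close> that vanish outside \<open>{1..n}\<close>,
  with pointwise addition and subtraction.\<close>

definition eps :: "nat \<Rightarrow> nat \<Rightarrow> real" where
  "eps i = (\<lambda>k. if k = i then 1 else 0)"

definition pos_roots_D :: "nat \<Rightarrow> (nat \<Rightarrow> real) set" where
  "pos_roots_D n = {eps i - eps j | i j. 1 \<le> i \<and> i < j \<and> j \<le> n}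
                 \<union> {eps i + eps j | i j. 1 \<le> i \<and> i < j \<and> j \<le> n}"

definition simple_roots_D :: "nat \<Rightarrow> (nat \<Rightarrow> real) set" where
  "simple_roots_D n = {eps i - eps (i + 1) | i. 1 \<le> i \<and> i < n} \<union> {eps (n - 1) + eps n}"

definition root_le_D :: "nat \<Rightarrow> (nat \<Rightarrow> real) \<Rightarrow> (nat \<Rightarrow> real) \<Rightarrow> bool" where
  "root_le_D n \<mu> \<gamma> \<longleftrightarrow>
     (\<mu>, \<gamma>) \<in> {(\<mu>, \<gamma>). \<mu> \<in> pos_roots_D n \<and> \<gamma> \<in> pos_roots_D n \<and> \<gamma> - \<mu> \<in> simple_roots_D n}\<^sup>*"

definition upper_ideal_D :: "nat \<Rightarrow> (nat \<Rightarrow> real) set \<Rightarrow> bool" where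
  "upper_ideal_D n I \<longleftrightarrow>
     I \<subseteq> pos_roots_D n \<and> (\<forall>\<mu>\<in>I. \<forall>\<gamma>\<in>pos_roots_D n. root_le_D n \<mu> \<gamma> \<longrightarrow> \<gamma> \<in> I)"

definition abelian_D :: "nat \<Rightarrow> (nat \<Rightarrow> real) set \<Rightarrow> bool" where
  "abelian_D n I \<longleftrightarrow> (\<forall>\<gamma>'\<in>I. \<forall>\<gamma>''\<in>I. \<gamma>' + \<gamma>'' \<notin> pos_roots_D n)"

definition abelian_ideals_D :: "nat \<Rightarrow> (nat \<Rightarrow> real) set set" where
  "abelian_ideals_D n = {I. upper_ideal_D n I \<and> abelian_D n I}"

lemma finite_abelian_ideals_D: "finite (abelian_ideals_D n)"
proof -
  have "pos_roots_D n \<subseteq>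
      (\<lambda>(i, j). eps i - eps j) ` ({1..n} \<times> {1..n}) \<union> (\<lambda>(i, j). eps i + eps j) ` ({1..n} \<times> {1..n})"
    unfolding pos_roots_D_def by force
  then have "finite (pos_roots_D n)"
    by (rule finite_subset) auto
  moreover have "abelian_ideals_D n \<subseteq> Pow (pos_roots_D n)"
    by (auto simp: abelian_ideals_D_def upper_ideal_D_def)
  ultimately show ?thesis
    by (meson finite_Pow_iff finite_subset)
qed

definition binom :: "nat \<Rightarrow> int \<Rightarrow> int" where
  "binom m k = (if k < 0 then 0 else int (m choose nat k))"

end

(* The roots eps i + eps j and eps i - eps j are coded by the symbols Pl i j and Mi i j, on which the
   root order and the relation "the sum is a root" become explicit conditions on indices.
   An abelian ideal that contains at most one of eps 1 + eps n and eps 1 - eps n is, up to the diagram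
   automorphism eps n |-> - eps n, an up-closed subset of the staircase of the roots eps i + eps j.
   One that contains both consists of the roots eps 1 + eps j for all j, the roots eps 1 - eps j for
   all j >= b, and an up-closed subset of the staircase on the indices 2, ..., b - 1.
   Coverings in the poset add or remove a single root. An up-closed subset of the staircase on
   a, ..., b either avoids the tip (a, b), and then lives on a, ..., b - 1, or contains the whole row
   of a, and then the rest lives on a + 1, ..., b. Tracking membership of the tip, this recursion
   becomes Pascal's rule for the numbers binom m (2 k) and binom m (2 k - 1). *)

theory Submission
  imports Defs
begin

section \<open>Coded roots\<close>

datatype root = Pl nat nat | Mi nat nat

text \<open>Nonnegative vectors come from multisets of indices. With negative terms moved across, an
  equation between roots becomes one between small multisets, which case analysis settles.\<close>

definition ev :: "nat multiset \<Rightarrow> nat \<Rightarrow> real" where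
  "ev M = (\<lambda>k. real (count M k))"

lemma ev_add: "ev (M + N) = ev M + ev N"
  by (simp add: ev_def fun_eq_iff)

lemma ev_eq_iff: "ev M = ev N \<longleftrightarrow> M = N"
  by (auto simp: ev_def fun_eq_iff multiset_eq_iff)

lemma eps_eq_ev: "eps i = ev {#i#}"
  by (simp add: eps_def ev_def fun_eq_iff)

fun pos_part neg_part :: "root \<Rightarrow> nat multiset" where
  "pos_part (Pl i j) = {#i, j#}"
| "pos_part (Mi i j) = {#i#}"
| "neg_part (Pl i j) = {#}"
| "neg_part (Mi i j) = {#j#}"

definition vec :: "root \<Rightarrow> nat \<Rightarrow> real" where
  "vec r = ev (pos_part r) - ev (neg_part r)"

lemma vec_simps: "vec (Pl i j) = eps i + eps j" "vec (Mi i j) = eps i - eps j"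
  by (auto simp: vec_def ev_def eps_def fun_eq_iff)

fun is_root :: "nat \<Rightarrow> root \<Rightarrow> bool" where
  "is_root n (Pl i j) \<longleftrightarrow> 1 \<le> i \<and> i < j \<and> j \<le> n"
| "is_root n (Mi i j) \<longleftrightarrow> 1 \<le> i \<and> i < j \<and> j \<le> n"

text \<open>Read upwards: \<open>s\<close> arises from \<open>r\<close> by adding a simple root. The
  mixed clause adds \<open>eps (n - 1) + eps n\<close>, which sends \<open>eps i - eps n\<close> to
  \<open>eps i + eps (n - 1)\<close> and \<open>eps i - eps (n - 1)\<close> to
  \<open>eps i + eps n\<close>.\<close>

fun step :: "nat \<Rightarrow> root \<Rightarrow> root \<Rightarrow> bool" where
  "step n (Pl i j) (Pl k l) \<longleftrightarrow> Suc k = i \<and> l = j \<or> k = i \<and> Suc l = j"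
| "step n (Mi i j) (Mi k l) \<longleftrightarrow> Suc k = i \<and> l = j \<or> k = i \<and> l = Suc j"
| "step n (Mi i j) (Pl k l) \<longleftrightarrow> k = i \<and> (j = n \<and> Suc l = n \<or> Suc j = n \<and> l = n)"
| "step n (Pl i j) (Mi k l) \<longleftrightarrow> False"

text \<open>An index has to cancel in the sum; the inequalities exclude sums that are twice a unit
  vector.\<close>

fun clash :: "root \<Rightarrow> root \<Rightarrow> bool" where
  "clash (Pl a b) (Pl c d) \<longleftrightarrow> False"
| "clash (Mi a b) (Pl c d) \<longleftrightarrow> b = c \<and> a \<noteq> d \<or> b = d \<and> a \<noteq> c"
| "clash (Pl c d) (Mi a b) \<longleftrightarrow> b = c \<and> a \<noteq> d \<or> b = d \<and> a \<noteq> c"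
| "clash (Mi a b) (Mi c d) \<longleftrightarrow> b = c \<or> a = d"

lemma pos_roots_eq: "pos_roots_D n = vec ` {r. is_root n r}"
proof -
  have "{r. is_root n r} = {Mi i j | i j. 1 \<le> i \<and> i < j \<and> j \<le> n} \<union>
      {Pl i j | i j. 1 \<le> i \<and> i < j \<and> j \<le> n}"
    by (intro set_eqI) (case_tac x; auto)
  then show ?thesis
    unfolding pos_roots_D_def image_Un
    by (simp only: image_Collect vec_simps ex_simps flip: vec_simps) blast
qed

lemma inj_vec: "inj_on vec {r. is_root n r}"
proof (rule inj_onI, clarsimp)
  fix r s assume rs: "is_root n r" "is_root n s" "vec r = vec s"
  then have "ev (pos_part r + neg_part s) = ev (pos_part s + neg_part r)"
    by (simp add: vec_def ev_add algebra_simps)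
  then have "pos_part r + neg_part s = pos_part s + neg_part r"
    by (simp add: ev_eq_iff)
  \<comment> \<open>A plus code against a minus code would equate multisets of sizes 3 and 1, which
    \<open>size\<close> refutes.\<close>
  with rs(1,2) show "r = s"
    by (cases r; cases s) (auto simp: add_eq_conv_ex dest: arg_cong[where f = size])
qed

lemma vec_diff_eq_iff:
  "vec s - vec r = ev A - ev B \<longleftrightarrow> pos_part s + neg_part r + B = pos_part r + neg_part s + A"
proof -
  have "vec s - vec r = ev A - ev B \<longleftrightarrow>
      ev (pos_part s + neg_part r + B) = ev (pos_part r + neg_part s + A)"
    by (auto simp: vec_def ev_add algebra_simps fun_eq_iff)
  then show ?thesis by (simp add: ev_eq_iff)
qed

lemma triple_mset_eq:
  "{#a, b, c#} = {#d, e, f#} \<longleftrightarrow>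
     a = d \<and> (b = e \<and> c = f \<or> b = f \<and> c = e) \<or> a = e \<and> (b = d \<and> c = f \<or> b = f \<and> c = d)
   \<or> a = f \<and> (b = d \<and> c = e \<or> b = e \<and> c = d)"
  by (auto simp: add_eq_conv_ex)

text \<open>For each pair of codes the two multisets either differ in size or have three elements
  each, and then \<open>triple_mset_eq\<close> lists the solutions.\<close>

lemma step_iff:
  assumes "is_root n r" "is_root n s"
  shows "vec s - vec r \<in> simple_roots_D n \<longleftrightarrow> step n r s"
proof -
  have "vec s - vec r \<in> simple_roots_D n \<longleftrightarrow>
     (\<exists>k. 1 \<le> k \<and> k < n \<and> vec s - vec r = ev {#k#} - ev {#Suc k#}) \<or>
      vec s - vec r = ev {#n - 1, n#} - ev {#}"
    by (auto simp: simple_roots_D_def eps_eq_ev ev_add[symmetric] ev_def)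
  also have "\<dots> \<longleftrightarrow> step n r s"
    unfolding vec_diff_eq_iff using assms
    by (cases r; cases s) (auto simp: triple_mset_eq dest: arg_cong[where f = size])
  finally show ?thesis .
qed

lemma ex_root:
  "(\<exists>r. is_root n r \<and> Q r) \<longleftrightarrow> (\<exists>i j. 1 \<le> i \<and> i < j \<and> j \<le> n \<and> (Q (Pl i j) \<or> Q (Mi i j)))"
  (is "?l \<longleftrightarrow> ?r")
proof
  assume ?l
  then obtain r where "is_root n r" "Q r" by blast
  then show ?r by (cases r) auto
next
  assume ?r
  then show ?l by (metis is_root.simps)
qed

lemma clash_iff:
  assumes "is_root n r" "is_root n s"
  shows "vec r + vec s \<in> pos_roots_D n \<longleftrightarrow> clash r s"
proof -
  have "vec r + vec s \<in> pos_roots_D n \<longleftrightarrow> (\<exists>t. is_root n t \<and> vec t = vec r + vec s)"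
    by (auto simp: pos_roots_eq image_iff)
  also have "\<dots> \<longleftrightarrow> (\<exists>t. is_root n t \<and> vec t - vec r = ev (pos_part s) - ev (neg_part s))"
    by (intro ex_cong1 conj_cong refl) (auto simp: vec_def algebra_simps)
  also have "\<dots> \<longleftrightarrow> (\<exists>t. is_root n t \<and>
      pos_part t + neg_part r + neg_part s = pos_part r + neg_part t + pos_part s)"
    unfolding vec_diff_eq_iff ..
  also have "\<dots> \<longleftrightarrow> (\<exists>i j. 1 \<le> i \<and> i < j \<and> j \<le> n \<and>
      ({#i, j#} + neg_part r + neg_part s = pos_part r + pos_part s \<or>
       {#i#} + neg_part r + neg_part s = pos_part r + {#j#} + pos_part s))"
    unfolding ex_root by simp
  also have "\<dots> \<longleftrightarrow> clash r s"
    using assms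
    by (cases r; cases s) (auto simp: triple_mset_eq nat_neq_iff dest: arg_cong[where f = size])
  finally show ?thesis .
qed

section \<open>Coverings in the poset of abelian ideals\<close>

text \<open>An order embedding carries covering pairs to covering pairs of the image. It serves
  twice: to pass from vectors to codes, and for the symmetry \<open>flip\<close>.\<close>

lemma covering_polys_image:
  fixes f :: "'a::order \<Rightarrow> 'b::order"
  assumes "\<And>x y. x \<in> P \<Longrightarrow> y \<in> P \<Longrightarrow> f x \<le> f y \<longleftrightarrow> x \<le> y"
  shows kappa_image: "x \<in> P \<Longrightarrow> kappa (f ` P) (f x) = kappa P x"
    and iota_image: "x \<in> P \<Longrightarrow> iota (f ` P) (f x) = iota P x"
    and upper_covering_poly_image: "upper_covering_poly (f ` P) = upper_covering_poly P"
    and lower_covering_poly_image: "lower_covering_poly (f ` P) = lower_covering_poly P"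
proof -
  have inj: "inj_on f P"
    using assms by (metis inj_onI order_antisym order_refl)
  have less: "f x < f y \<longleftrightarrow> x < y" if "x \<in> P" "y \<in> P" for x y
    using assms that by (auto simp: less_le_not_le)
  have cov: "covered_in (f ` P) (f x) (f y) \<longleftrightarrow> covered_in P x y" if "x \<in> P" "y \<in> P" for x y
    using that less by (auto simp: covered_in_def)
  have kappa: "kappa (f ` P) (f x) = kappa P x" if "x \<in> P" for x
  proof -
    have "{y \<in> f ` P. covered_in (f ` P) y (f x)} = f ` {y \<in> P. covered_in P y x}"
      using cov that by auto
    then show ?thesis
      unfolding kappa_def by (metis (no_types, lifting) card_image inj inj_on_subset mem_Collect_eq subsetI)
  qed
  then show "x \<in> P \<Longrightarrow> kappa (f ` P) (f x) = kappa P x" .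
  have iota: "iota (f ` P) (f x) = iota P x" if "x \<in> P" for x
  proof -
    have "{y \<in> f ` P. covered_in (f ` P) (f x) y} = f ` {y \<in> P. covered_in P x y}"
      using cov that by auto
    then show ?thesis
      unfolding iota_def by (metis (no_types, lifting) card_image inj inj_on_subset mem_Collect_eq subsetI)
  qed
  then show "x \<in> P \<Longrightarrow> iota (f ` P) (f x) = iota P x" .
  show "upper_covering_poly (f ` P) = upper_covering_poly P"
    unfolding upper_covering_poly_def sum.reindex[OF inj] by (simp add: kappa)
  show "lower_covering_poly (f ` P) = lower_covering_poly P"
    unfolding lower_covering_poly_def sum.reindex[OF inj] by (simp add: iota)
qed

text \<open>A strict inclusion can be shortened by deleting one element of the difference. Hence
  covering pairs differ by one element, and \<open>kappa\<close> and \<open>iota\<close> count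
  deletable and addable elements.\<close>

locale shrinkable =
  fixes \<A> :: "'a set set"
  assumes shrink: "I \<in> \<A> \<Longrightarrow> J \<in> \<A> \<Longrightarrow> I \<subset> J \<Longrightarrow> \<exists>r\<in>J - I. J - {r} \<in> \<A>"
begin

lemma covered_in_iff:
  "covered_in \<A> I J \<longleftrightarrow> I \<in> \<A> \<and> J \<in> \<A> \<and> (\<exists>r. r \<notin> I \<and> J = insert r I)"
proof
  assume cov: "covered_in \<A> I J"
  then have mem: "I \<in> \<A>" "J \<in> \<A>" "I \<subset> J"
    by (auto simp: covered_in_def)
  from shrink[OF this] obtain r where r: "r \<in> J" "r \<notin> I" "J - {r} \<in> \<A>" by auto
  \<comment> \<open>\<open>J - {r}\<close> still contains \<open>I\<close>; strict inclusion would
    put a member of the family strictly between \<open>I\<close> and \<open>J\<close>.\<close>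
  then have "\<not> I \<subset> J - {r}" using cov by (auto simp: covered_in_def)
  with r mem have "J = insert r I" by blast
  with mem r show "I \<in> \<A> \<and> J \<in> \<A> \<and> (\<exists>r. r \<notin> I \<and> J = insert r I)" by blast
next
  assume "I \<in> \<A> \<and> J \<in> \<A> \<and> (\<exists>r. r \<notin> I \<and> J = insert r I)"
  then show "covered_in \<A> I J"
    unfolding covered_in_def by blast
qed

lemma kappa_eq:
  assumes "J \<in> \<A>"
  shows "kappa \<A> J = card {r \<in> J. J - {r} \<in> \<A>}"
proof -
  have "{I \<in> \<A>. covered_in \<A> I J} = (\<lambda>r. J - {r}) ` {r \<in> J. J - {r} \<in> \<A>}"
    unfolding covered_in_iff using assms by (auto simp: insert_absorb)
  moreover have "inj_on (\<lambda>r. J - {r}) {r \<in> J. J - {r} \<in> \<A>}"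
    by (rule inj_onI) blast
  ultimately show ?thesis
    unfolding kappa_def by (simp add: card_image)
qed

lemma iota_eq:
  assumes "I \<in> \<A>"
  shows "iota \<A> I = card {r. r \<notin> I \<and> insert r I \<in> \<A>}"
proof -
  have "{J \<in> \<A>. covered_in \<A> I J} = (\<lambda>r. insert r I) ` {r. r \<notin> I \<and> insert r I \<in> \<A>}"
    unfolding covered_in_iff using assms by auto
  moreover have "inj_on (\<lambda>r. insert r I) {r. r \<notin> I \<and> insert r I \<in> \<A>}"
    by (rule inj_onI) blast
  ultimately show ?thesis
    unfolding iota_def by (simp add: card_image)
qed

end

section \<open>Abelian ideals as sets of coded roots\<close>

definition ideals :: "nat \<Rightarrow> root set set" where
  "ideals n = {I. I \<subseteq> {r. is_root n r} \<and> (\<forall>r\<in>I. \<forall>s. is_root n s \<longrightarrow> step n r s \<longrightarrow> s \<in> I)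
     \<and> (\<forall>r\<in>I. \<forall>s\<in>I. \<not> clash r s)}"

text \<open>The root order is generated by single additions of simple roots within the positive
  roots, so closure under one addition propagates along chains.\<close>

lemma upper_ideal_D_iff:
  "upper_ideal_D n I \<longleftrightarrow> I \<subseteq> pos_roots_D n \<and>
     (\<forall>\<mu>\<in>I. \<forall>\<gamma>\<in>pos_roots_D n. \<gamma> - \<mu> \<in> simple_roots_D n \<longrightarrow> \<gamma> \<in> I)" (is "?l \<longleftrightarrow> ?r")
proof
  assume ?l
  then show ?r
    unfolding upper_ideal_D_def root_le_D_def by (blast intro: r_into_rtrancl)
next
  assume r: ?r
  have "\<gamma> \<in> I" if "root_le_D n \<mu> \<gamma>" "\<mu> \<in> I" for \<mu> \<gamma>
    using that(1) unfolding root_le_D_def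
    by (induction rule: rtrancl_induct) (use that(2) r in auto)
  with r show ?l
    unfolding upper_ideal_D_def by blast
qed

lemma ball_roots: "(\<forall>\<gamma>\<in>pos_roots_D n. Q \<gamma>) \<longleftrightarrow> (\<forall>s. is_root n s \<longrightarrow> Q (vec s))"
  by (simp add: pos_roots_eq)

lemma abelian_ideals_D_eq: "abelian_ideals_D n = image vec ` ideals n"
proof -
  have "vec ` I \<in> abelian_ideals_D n \<longleftrightarrow> I \<in> ideals n" if "I \<subseteq> {r. is_root n r}" for I
  proof -
    have mem: "vec s \<in> vec ` I \<longleftrightarrow> s \<in> I" if "is_root n s" for s
      using \<open>I \<subseteq> _\<close> that inj_vec by (auto simp: inj_on_def)
    have "vec ` I \<in> abelian_ideals_D n \<longleftrightarrow>
        (\<forall>r\<in>I. \<forall>s. is_root n s \<longrightarrow> vec s - vec r \<in> simple_roots_D n \<longrightarrow> vec s \<in> vec ` I) \<and>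
        (\<forall>r\<in>I. \<forall>s\<in>I. vec r + vec s \<notin> pos_roots_D n)"
    proof -
      have "vec ` I \<subseteq> pos_roots_D n" using that by (auto simp: pos_roots_eq)
      then show ?thesis
        unfolding abelian_ideals_D_def upper_ideal_D_iff abelian_D_def
        using ball_roots by simp
    qed
    also have "\<dots> \<longleftrightarrow> I \<in> ideals n"
    proof -
      have "(\<forall>r\<in>I. \<forall>s. is_root n s \<longrightarrow> vec s - vec r \<in> simple_roots_D n \<longrightarrow> vec s \<in> vec ` I)
          \<longleftrightarrow> (\<forall>r\<in>I. \<forall>s. is_root n s \<longrightarrow> step n r s \<longrightarrow> s \<in> I)"
        using that by (intro ball_cong refl all_cong1 imp_cong) (auto simp: step_iff mem)
      moreover have "(\<forall>r\<in>I. \<forall>s\<in>I. vec r + vec s \<notin> pos_roots_D n) \<longleftrightarrow> (\<forall>r\<in>I. \<forall>s\<in>I. \<not> clash r s)"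
        using that clash_iff[of n] by (intro ball_cong refl) (auto simp: subset_iff)
      ultimately show ?thesis using that by (simp add: ideals_def)
    qed
    finally show ?thesis .
  qed
  note iff = this
  have "\<exists>J. J \<subseteq> {r. is_root n r} \<and> I = vec ` J" if "I \<in> abelian_ideals_D n" for I
    using that subset_image_iff[of I vec "{r. is_root n r}"]
    by (auto simp: abelian_ideals_D_def upper_ideal_D_def pos_roots_eq)
  moreover have "I \<subseteq> {r. is_root n r}" if "I \<in> ideals n" for I
    using that by (auto simp: ideals_def)
  ultimately show ?thesis
    using iff by (intro subset_antisym subsetI; (elim imageE)?) fastforce+
qed

lemma ideals_image_mono:
  assumes "I \<in> ideals n" "J \<in> ideals n"
  shows "vec ` I \<le> vec ` J \<longleftrightarrow> I \<le> J"
proof -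
  have "vec r \<in> vec ` J \<longleftrightarrow> r \<in> J" if "r \<in> I" for r
    using assms that by (intro inj_on_image_mem_iff[OF inj_vec]) (auto simp: ideals_def)
  then show ?thesis by (auto simp: image_subset_iff)
qed

text \<open>For valid codes this is the height of the root plus \<open>n\<close>, arranged so that
  natural subtraction does not truncate.\<close>

fun rank :: "nat \<Rightarrow> root \<Rightarrow> nat" where
  "rank n (Pl i j) = (n - i) + (2 * n - j)"
| "rank n (Mi i j) = (n - i) + j"

lemma step_rank: "is_root n r \<Longrightarrow> is_root n s \<Longrightarrow> step n r s \<Longrightarrow> rank n r < rank n s"
  by (cases r; cases s) auto

text \<open>An element of \<open>J - I\<close> that is minimal there is minimal in \<open>J\<close>, as \<open>I\<close> is up-closed.\<close>

interpretation ideals: shrinkable "ideals n" for n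
proof
  fix I J assume IJ: "I \<in> ideals n" "J \<in> ideals n" "I \<subset> J"
  then obtain r where r: "r \<in> J - I" "\<And>s. s \<in> J - I \<Longrightarrow> rank n r \<le> rank n s"
    using ex_has_least_nat[of "\<lambda>r. r \<in> J - I" _ "rank n"] by blast
  have "\<not> step n s r" if "s \<in> J" for s
  proof
    assume s: "step n s r"
    have "is_root n r" "is_root n s" using r that IJ by (auto simp: ideals_def)
    with s have "rank n s < rank n r" by (simp add: step_rank)
    with r(2) that have "s \<in> I" by force
    with s IJ(1) \<open>is_root n r\<close> r(1) show False by (auto simp: ideals_def)
  qed
  with IJ(2) have "J - {r} \<in> ideals n" by (auto simp: ideals_def)
  with r(1) show "\<exists>r\<in>J - I. J - {r} \<in> ideals n" by blast
qed

text \<open>Subsets of abelian sets are abelian, so deleting \<open>r\<close> can only break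
  up-closure, and does so exactly when a member of \<open>I\<close> lies directly below
  \<open>r\<close>.\<close>

lemma kappa_ideals:
  assumes "I \<in> ideals n"
  shows "kappa (ideals n) I = card {r \<in> I. \<forall>s\<in>I. \<not> step n s r}"
proof -
  have "{r \<in> I. I - {r} \<in> ideals n} = {r \<in> I. \<forall>s\<in>I. \<not> step n s r}"
  proof -
    have "\<not> step n r r" for r by (cases r) auto
    then show ?thesis using assms unfolding ideals_def by (intro set_eqI) blast
  qed
  then show ?thesis using ideals.kappa_eq[OF assms] by simp
qed

text \<open>Twice a root is not a root and \<open>clash\<close> is symmetric, so only clashes of
  \<open>r\<close> with old members matter; irreflexivity of \<open>step\<close> removes
  \<open>r\<close> from its own required covers.\<close>

lemma iota_ideals:
  assumes "I \<in> ideals n"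
  shows "iota (ideals n) I = card {r. is_root n r \<and> r \<notin> I \<and>
    (\<forall>s. is_root n s \<longrightarrow> step n r s \<longrightarrow> s \<in> I) \<and> (\<forall>s\<in>I. \<not> clash r s)}"
proof -
  have step: "\<not> step n r r" for r by (cases r) auto
  have clash: "\<not> clash r r" if "is_root n r" for r using that by (cases r) auto
  have sym: "clash r s \<longleftrightarrow> clash s r" for r s by (cases r; cases s) auto
  have "insert r I \<in> ideals n \<longleftrightarrow> is_root n r \<and>
      (\<forall>s. is_root n s \<longrightarrow> step n r s \<longrightarrow> s \<in> I) \<and> (\<forall>s\<in>I. \<not> clash r s)" for r
  proof -
    have "insert r I \<in> ideals n \<longleftrightarrow> is_root n r \<and>
      (\<forall>s. is_root n s \<longrightarrow> step n r s \<longrightarrow> s = r \<or> s \<in> I) \<and>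
      \<not> clash r r \<and> (\<forall>s\<in>I. \<not> clash r s) \<and> (\<forall>s\<in>I. \<not> clash s r)"
      using assms unfolding ideals_def mem_Collect_eq ball_simps insert_subset insert_iff by blast
    then show ?thesis
      using step[of r] clash[of r] sym[of r] by metis
  qed
  then have "{r. r \<notin> I \<and> insert r I \<in> ideals n} = {r. is_root n r \<and> r \<notin> I \<and>
    (\<forall>s. is_root n s \<longrightarrow> step n r s \<longrightarrow> s \<in> I) \<and> (\<forall>s\<in>I. \<not> clash r s)}"
    by blast
  then show ?thesis using ideals.iota_eq[OF assms] by simp
qed

section \<open>Up-closed subsets of the staircase\<close>

definition triangle :: "nat \<Rightarrow> nat \<Rightarrow> (nat \<times> nat) set" where
  "triangle a b = {(i, j). a \<le> i \<and> i < j \<and> j \<le> b}"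

text \<open>Decreasing an index of \<open>eps i + eps j\<close> moves up in the root order. With
  \<open>i\<close> as row and \<open>j\<close> as column these sets are shifted Young
  diagrams.\<close>

definition shapes :: "nat \<Rightarrow> nat \<Rightarrow> (nat \<times> nat) set set" where
  "shapes a b = {J. J \<subseteq> triangle a b \<and>
     (\<forall>i j k l. (i, j) \<in> J \<longrightarrow> a \<le> k \<longrightarrow> k \<le> i \<longrightarrow> k < l \<longrightarrow> l \<le> j \<longrightarrow> (k, l) \<in> J)}"

definition row :: "nat \<Rightarrow> nat \<Rightarrow> (nat \<times> nat) set" where
  "row a b = {(i, j). i = a \<and> a < j \<and> j \<le> b}"

text \<open>Removable boxes, that is, the minimal roots of the shape.\<close>

definition corners :: "(nat \<times> nat) set \<Rightarrow> (nat \<times> nat) set" where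
  "corners J = {(i, j). (i, j) \<in> J \<and> (Suc i, j) \<notin> J \<and> (i, Suc j) \<notin> J}"

text \<open>Addable boxes; \<open>i = a\<close> and \<open>j = Suc i\<close> cover border boxes
  without a neighbour above or to the left.\<close>

definition gaps :: "nat \<Rightarrow> nat \<Rightarrow> (nat \<times> nat) set \<Rightarrow> (nat \<times> nat) set" where
  "gaps a b J = {(i, j). a \<le> i \<and> i < j \<and> j \<le> b \<and> (i, j) \<notin> J \<and>
     (i = a \<or> (i - 1, j) \<in> J) \<and> (j = Suc i \<or> (i, j - 1) \<in> J)}"

lemma shapesD:
  assumes "J \<in> shapes a b"
  shows "(i, j) \<in> J \<Longrightarrow> a \<le> i \<and> i < j \<and> j \<le> b"
    and "(i, j) \<in> J \<Longrightarrow> a \<le> k \<Longrightarrow> k \<le> i \<Longrightarrow> k < l \<Longrightarrow> l \<le> j \<Longrightarrow> (k, l) \<in> J"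
  using assms by (auto simp: shapes_def triangle_def)

lemma shapesI:
  assumes "\<And>i j. (i, j) \<in> J \<Longrightarrow> a \<le> i \<and> i < j \<and> j \<le> b"
    and "\<And>i j k l. (i, j) \<in> J \<Longrightarrow> a \<le> k \<Longrightarrow> k \<le> i \<Longrightarrow> k < l \<Longrightarrow> l \<le> j \<Longrightarrow> (k, l) \<in> J"
  shows "J \<in> shapes a b"
  unfolding shapes_def triangle_def mem_Collect_eq
  by (intro conjI subsetI allI impI; (rule assms(2); assumption)?) (use assms(1) in auto)

lemma finite_triangle: "finite (triangle a b)"
  by (rule finite_subset[of _ "{..b} \<times> {..b}"]) (auto simp: triangle_def)

lemma finite_shapes: "finite (shapes a b)"
  by (rule finite_subset[of _ "Pow (triangle a b)"]) (auto simp: shapes_def finite_triangle)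

lemma finite_shape: "J \<in> shapes a b \<Longrightarrow> finite J"
  using finite_triangle by (auto simp: shapes_def intro: finite_subset)

lemma shapes_trivial: "b \<le> a \<Longrightarrow> shapes a b = {{}}"
  by (auto simp: shapes_def triangle_def)

lemma finite_corners: "J \<in> shapes a b \<Longrightarrow> finite (corners J)"
  by (rule finite_subset[of _ J]) (auto simp: corners_def finite_shape)

lemma finite_gaps: "finite (gaps a b J)"
  by (rule finite_subset[OF _ finite_triangle[of a b]]) (auto simp: gaps_def triangle_def)

text \<open>Any box in column \<open>Suc b\<close> forces the tip \<open>(a, Suc b)\<close>, so
  without the tip this column is empty.\<close>

lemma shapes_without_tip:
  assumes "a \<le> b"
  shows "{J \<in> shapes a (Suc b). (a, Suc b) \<notin> J} = shapes a b"
proof (intro subset_antisym subsetI CollectI conjI)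
  fix J assume "J \<in> {J \<in> shapes a (Suc b). (a, Suc b) \<notin> J}"
  then have J: "J \<in> shapes a (Suc b)" "(a, Suc b) \<notin> J" by auto
  show "J \<in> shapes a b"
  proof (rule shapesI)
    fix i j assume ij: "(i, j) \<in> J"
    have "j \<noteq> Suc b"
      using shapesD(1)[OF J(1) ij] shapesD(2)[OF J(1) ij, of a j] J(2) by auto
    with shapesD(1)[OF J(1) ij] show "a \<le> i \<and> i < j \<and> j \<le> b" by auto
  qed (rule shapesD(2)[OF J(1)])
next
  fix J assume J: "J \<in> shapes a b"
  show "J \<in> shapes a (Suc b)"
  proof (rule shapesI)
    fix i j assume "(i, j) \<in> J"
    from shapesD(1)[OF J this] show "a \<le> i \<and> i < j \<and> j \<le> Suc b" by auto
  qed (rule shapesD(2)[OF J])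
  show "(a, Suc b) \<notin> J" by (auto dest: shapesD(1)[OF J])
qed

lemma shapes_subset_Suc: "a \<le> b \<Longrightarrow> shapes a b \<subseteq> shapes a (Suc b)"
  using shapes_without_tip[of a b] by blast

text \<open>The tip forces all of row \<open>a\<close>. Below a full row every shape on
  \<open>Suc a, ..., b\<close> may occur, since the boxes it requires in row \<open>a\<close> are
  present.\<close>

lemma shapes_with_tip:
  assumes "a < b"
  shows "{J \<in> shapes a b. (a, b) \<in> J} = (\<union>) (row a b) ` shapes (Suc a) b"
proof (intro subset_antisym subsetI)
  fix J assume "J \<in> {J \<in> shapes a b. (a, b) \<in> J}"
  then have J: "J \<in> shapes a b" "(a, b) \<in> J" by auto
  let ?J = "{(i, j). (i, j) \<in> J \<and> i \<noteq> a}"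
  have "?J \<in> shapes (Suc a) b"
  proof (rule shapesI)
    fix i j assume "(i, j) \<in> ?J"
    then show "Suc a \<le> i \<and> i < j \<and> j \<le> b"
      using shapesD(1)[OF J(1), of i j] by auto
  next
    fix i j k l assume "(i, j) \<in> ?J" "Suc a \<le> k" "k \<le> i" "k < l" "l \<le> j"
    then show "(k, l) \<in> ?J"
      using shapesD(2)[OF J(1), of i j k l] by auto
  qed
  moreover have "row a b \<union> ?J = J"
    using shapesD(2)[OF J, of a] shapesD(1)[OF J(1)] by (auto simp: row_def)
  ultimately show "J \<in> (\<union>) (row a b) ` shapes (Suc a) b"
    by (intro image_eqI[of _ _ ?J]) simp_all
next
  fix J assume "J \<in> (\<union>) (row a b) ` shapes (Suc a) b"
  then obtain J' where J: "J = row a b \<union> J'" "J' \<in> shapes (Suc a) b" by auto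
  have "J \<in> shapes a b"
  proof (rule shapesI)
    fix i j assume "(i, j) \<in> J"
    then show "a \<le> i \<and> i < j \<and> j \<le> b"
      using shapesD(1)[OF J(2), of i j] J(1) by (auto simp: row_def)
  next
    fix i j k l assume "(i, j) \<in> J" "a \<le> k" "k \<le> i" "k < l" "l \<le> j"
    then show "(k, l) \<in> J"
      using shapesD(1)[OF J(2), of i j] shapesD(2)[OF J(2), of i j k l] J(1)
      by (cases "k = a") (auto simp: row_def)
  qed
  then show "J \<in> {J \<in> shapes a b. (a, b) \<in> J}"
    using assms J(1) by (auto simp: row_def)
qed

lemma inj_row_union: "inj_on ((\<union>) (row a b)) (shapes (Suc a) b)"
proof (rule inj_onI)
  fix J J' assume J: "J \<in> shapes (Suc a) b" "J' \<in> shapes (Suc a) b" "row a b \<union> J = row a b \<union> J'"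
  have "row a b \<inter> J = {}" "row a b \<inter> J' = {}"
    by (auto simp: row_def dest: shapesD(1)[OF J(1)] shapesD(1)[OF J(2)])
  with J(3) show "J = J'" by blast
qed

text \<open>Every box of the full row but the last has a right neighbour, so \<open>(a, b)\<close>
  is the only possible new corner; \<open>(Suc a, b)\<close> below it prevents this.\<close>

lemma card_corners_row:
  assumes "J \<in> shapes (Suc a) b" "a < b"
  shows "card (corners (row a b \<union> J)) = card (corners J) + (if (Suc a, b) \<in> J then 0 else 1)"
proof -
  have "p \<in> corners (row a b \<union> J) \<longleftrightarrow>
      p \<in> (if (Suc a, b) \<in> J then {} else {(a, b)}) \<union> corners J" for p
  proof (cases p)
    case (Pair i j)
    have "(a, k) \<notin> J" "(i, j) \<in> J \<Longrightarrow> a < i" for k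
      using shapesD(1)[OF assms(1), of a k] shapesD(1)[OF assms(1), of i j] by auto
    then show ?thesis
      using Pair assms(2)
      by (cases "i = a"; cases "j = b") (auto simp: corners_def row_def)
  qed
  then have "corners (row a b \<union> J) = (if (Suc a, b) \<in> J then {} else {(a, b)}) \<union> corners J"
    by blast
  moreover have "(a, b) \<notin> corners J"
    using shapesD(1)[OF assms(1), of a b] by (auto simp: corners_def)
  ultimately show ?thesis
    using finite_corners[OF assms(1)] by simp
qed

text \<open>Column \<open>Suc b\<close> is empty, so only its top box can be added. This needs the
  box \<open>(a, b)\<close> on its left, unless \<open>a = b\<close>, when no such box
  exists.\<close>

lemma card_gaps_Suc:
  assumes "J \<in> shapes a b" "a \<le> b"
  shows "card (gaps a (Suc b) J) = card (gaps a b J) + (if a = b \<or> (a, b) \<in> J then 1 else 0)"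
proof -
  have "gaps a (Suc b) J = (if a = b \<or> (a, b) \<in> J then {(a, Suc b)} else {}) \<union> gaps a b J"
  proof (intro set_eqI)
    fix p show "p \<in> gaps a (Suc b) J \<longleftrightarrow>
      p \<in> (if a = b \<or> (a, b) \<in> J then {(a, Suc b)} else {}) \<union> gaps a b J"
    proof (cases p)
      case (Pair i j)
      have "(k, Suc b) \<notin> J" for k
        using shapesD(1)[OF assms(1), of k "Suc b"] by auto
      then show ?thesis
        using Pair assms(2) by (cases "j = Suc b") (auto simp: gaps_def)
    qed
  qed
  moreover have "(a, Suc b) \<notin> gaps a b J"
    by (simp add: gaps_def)
  ultimately show ?thesis
    using finite_gaps by simp
qed

text \<open>The full row has no gap and supplies the upper neighbours of row \<open>Suc a\<close>,
  matching the border convention of \<open>gaps (Suc a) b\<close>.\<close>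

lemma gaps_row:
  assumes "J \<in> shapes (Suc a) b"
  shows "gaps a b (row a b \<union> J) = gaps (Suc a) b J"
proof (intro set_eqI)
  fix p show "p \<in> gaps a b (row a b \<union> J) \<longleftrightarrow> p \<in> gaps (Suc a) b J"
  proof (cases p)
    case (Pair i j)
    have "(a, k) \<notin> J" for k
      using shapesD(1)[OF assms(1), of a k] by auto
    then show ?thesis
      using Pair by (cases "i = a"; cases "i = Suc a") (auto simp: gaps_def row_def)
  qed
qed

lemma sum_shapes_split:
  "(\<Sum>J\<in>shapes a b. f J) = (\<Sum>J | J \<in> shapes a b \<and> P J. f J) + (\<Sum>J | J \<in> shapes a b \<and> \<not> P J. f J)"
  using sum.Int_Diff[OF finite_shapes, of f a b "{J. P J}"]
  by (simp add: Int_def set_diff_eq)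

lemma sum_shapes_without_tip:
  "a \<le> b \<Longrightarrow> (\<Sum>J | J \<in> shapes a (Suc b) \<and> (a, Suc b) \<notin> J. f J) = (\<Sum>J\<in>shapes a b. f J)"
  by (simp only: shapes_without_tip)

lemma sum_shapes_with_tip:
  "a < b \<Longrightarrow> (\<Sum>J | J \<in> shapes a b \<and> (a, b) \<in> J. f J) =
     (\<Sum>J\<in>shapes (Suc a) b. f (row a b \<union> J))"
  by (simp only: shapes_with_tip sum.reindex[OF inj_row_union] o_def)

section \<open>Generating functions of every second binomial coefficient\<close>

definition gf :: "nat \<Rightarrow> int \<Rightarrow> int fps" where
  "gf m c = Abs_fps (\<lambda>k. binom m (2 * int k + c))"

lemma binom_neg: "k < 0 \<Longrightarrow> binom m k = 0"
  by (simp add: binom_def)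

lemma binom_0_left: "binom 0 k = (if k = 0 then 1 else 0)"
  by (auto simp: binom_def)

lemma binom_Suc: "binom (Suc m) k = binom m k + binom m (k - 1)"
proof (cases "k \<le> 0")
  case False
  then obtain l where "nat k = Suc l" "nat (k - 1) = l" "k > 0"
    by (metis Suc_nat_eq_nat_zadd1 add.commute diff_add_cancel not_le zle_diff1_eq diff_ge_0_iff_ge int_one_le_iff_zero_less)
  then show ?thesis
    by (simp add: binom_def)
qed (auto simp: binom_def)

lemma gf_Suc: "gf (Suc m) c = gf m c + gf m (c - 1)"
  by (simp add: fps_eq_iff gf_def binom_Suc algebra_simps)

text \<open>The bound on \<open>c\<close> makes the constant term on the right vanish, its lower
  index being negative.\<close>

lemma X_mult_gf: "c < 2 \<Longrightarrow> fps_X * gf m c = gf m (c - 2)"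
proof (rule fps_ext)
  fix k assume "c < 2"
  then show "(fps_X * gf m c) $ k = gf m (c - 2) $ k"
    by (cases k) (simp_all add: gf_def binom_neg algebra_simps)
qed

lemma gf_0: "gf 0 0 = 1" "gf 0 (- 1) = 0" "gf 0 1 = 0"
proof -
  have odd: "2 * int k - 1 \<noteq> 0" "2 * int k + 1 \<noteq> 0" for k by presburger+
  show "gf 0 (- 1) = 0" "gf 0 1 = 0"
    unfolding fps_eq_iff gf_def binom_0_left using odd by simp_all
qed (auto simp: fps_eq_iff gf_def binom_0_left)

text \<open>With the tip, row \<open>a\<close> is removed; it carries a corner exactly when the rest
  lacks its own tip, which gives \<open>gf m (- 1) + fps_X * gf m 0\<close>. Without the tip, the
  last column is dropped and the two smaller cases add up. Pascal's rule closes both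
  recursions.\<close>

lemma corner_gf:
  "(\<Sum>J | J \<in> shapes a (a + m) \<and> (a, a + m) \<in> J. fps_X ^ card (corners J)) = gf m (- 1)"
  "(\<Sum>J | J \<in> shapes a (a + m) \<and> (a, a + m) \<notin> J. fps_X ^ card (corners J)) = gf m 0"
proof (induction m arbitrary: a)
  case 0
  {
    case 1
    show ?case by (auto simp: shapes_trivial gf_0 intro!: sum.neutral)
  next
    case 2
    have "{J. J = {} \<and> (a, a) \<notin> J} = {{}}" by auto
    then show ?case by (simp add: shapes_trivial gf_0 corners_def)
  }
next
  case (Suc m)
  {
    case 1
    have "(\<Sum>J | J \<in> shapes a (a + Suc m) \<and> (a, a + Suc m) \<in> J. fps_X ^ card (corners J)) =
       (\<Sum>J\<in>shapes (Suc a) (Suc a + m).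
          fps_X ^ (card (corners J) + (if (Suc a, Suc a + m) \<in> J then 0 else 1)))"
      by (subst sum_shapes_with_tip) (auto intro!: sum.cong simp: card_corners_row)
    also have "\<dots> = gf m (- 1) + gf m 0 * fps_X"
      unfolding sum_shapes_split[where P = "\<lambda>J. (Suc a, Suc a + m) \<in> J"]
        Suc.IH[of "Suc a", symmetric] sum_distrib_right
      by (intro arg_cong2[where f = "(+)"] sum.cong) auto
    finally show ?case by (simp add: gf_Suc X_mult_gf mult.commute[of _ fps_X])
  next
    case 2
    have "(\<Sum>J | J \<in> shapes a (a + Suc m) \<and> (a, a + Suc m) \<notin> J. fps_X ^ card (corners J)) =
       (\<Sum>J\<in>shapes a (a + m). fps_X ^ card (corners J) :: int fps)"
      by (simp add: sum_shapes_without_tip)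
    then show ?case
      unfolding sum_shapes_split[where P = "\<lambda>J. (a, a + m) \<in> J"] Suc.IH
      by (simp add: gf_Suc)
  }
qed

text \<open>The case \<open>m = 0\<close> counts as containing the tip: on enlarging the index range, the box
  \<open>(a, Suc a)\<close> is addable to the empty shape.\<close>

lemma gap_gf:
  "(\<Sum>J | J \<in> shapes a (a + m) \<and> (m = 0 \<or> (a, a + m) \<in> J). fps_X ^ card (gaps a (a + m) J)) = gf m 0"
  "(\<Sum>J | J \<in> shapes a (a + m) \<and> \<not> (m = 0 \<or> (a, a + m) \<in> J). fps_X ^ card (gaps a (a + m) J)) = gf m (- 1)"
proof (induction m arbitrary: a)
  case 0
  {
    case 1
    have "gaps a a {} = {}" by (auto simp: gaps_def)
    then show ?case by (simp add: shapes_trivial gf_0)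
  next
    case 2
    then show ?case by (simp add: shapes_trivial gf_0)
  }
next
  case (Suc m)
  {
    case 1
    have "(\<Sum>J | J \<in> shapes a (a + Suc m) \<and> (a, a + Suc m) \<in> J. fps_X ^ card (gaps a (a + Suc m) J)) =
       (\<Sum>J\<in>shapes (Suc a) (Suc a + m). fps_X ^ card (gaps (Suc a) (Suc a + m) J))"
      by (subst sum_shapes_with_tip) (auto intro!: sum.cong simp: gaps_row)
    also have "\<dots> = gf m 0 + gf m (- 1)"
      by (subst sum_shapes_split[where P = "\<lambda>J. m = 0 \<or> (Suc a, Suc a + m) \<in> J"])
        (simp only: Suc.IH)
    finally show ?case by (simp add: gf_Suc)
  next
    case 2
    \<comment> \<open>Dropping the empty last column loses the gap at the tip, which exists exactly
      when the smaller shape counts as containing its tip; hence the factor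
      \<open>fps_X\<close>.\<close>
    have "(\<Sum>J | J \<in> shapes a (a + Suc m) \<and> (a, a + Suc m) \<notin> J. fps_X ^ card (gaps a (a + Suc m) J)) =
       (\<Sum>J\<in>shapes a (a + m). fps_X ^ (card (gaps a (a + m) J) + (if m = 0 \<or> (a, a + m) \<in> J then 1 else 0)))"
      by (simp add: sum_shapes_without_tip card_gaps_Suc)
    also have "\<dots> = gf m 0 * fps_X + gf m (- 1)"
      unfolding sum_shapes_split[where P = "\<lambda>J. m = 0 \<or> (a, a + m) \<in> J"]
        Suc.IH[of a, symmetric] sum_distrib_right
      by (intro arg_cong2[where f = "(+)"] sum.cong) auto
    finally show ?case by (simp add: gf_Suc X_mult_gf mult.commute[of _ fps_X])
  }
qed

section \<open>Classification of the abelian ideals\<close>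

definition plus_roots :: "(nat \<times> nat) set \<Rightarrow> root set" where
  "plus_roots J = (\<lambda>(i, j). Pl i j) ` J"

lemma mem_plus_roots [simp]: "Pl i j \<in> plus_roots J \<longleftrightarrow> (i, j) \<in> J" "Mi i j \<notin> plus_roots J"
  by (auto simp: plus_roots_def)

lemma inj_plus_roots: "inj plus_roots"
  by (intro injI set_eqI) (metis mem_plus_roots(1) surj_pair)

lemma card_plus_roots [simp]: "card (plus_roots J) = card J"
  unfolding plus_roots_def by (rule card_image) (auto simp: inj_on_def)

lemma finite_plus_roots [simp]: "finite J \<Longrightarrow> finite (plus_roots J)"
  by (simp add: plus_roots_def)

definition fan :: "nat \<Rightarrow> nat \<Rightarrow> (nat \<times> nat) set \<Rightarrow> root set" where
  "fan n b J = plus_roots (row 1 n \<union> J) \<union> Mi 1 ` {b..n}"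

lemma mem_fan [simp]:
  "Pl i j \<in> fan n b J \<longleftrightarrow> i = 1 \<and> 1 < j \<and> j \<le> n \<or> (i, j) \<in> J"
  "Mi i j \<in> fan n b J \<longleftrightarrow> i = 1 \<and> b \<le> j \<and> j \<le> n"
  by (auto simp: fan_def row_def)

section \<open>The diagram automorphism negating \<open>eps n\<close>\<close>

fun flip :: "nat \<Rightarrow> root \<Rightarrow> root" where
  "flip n (Pl i j) = (if j = n then Mi i j else Pl i j)"
| "flip n (Mi i j) = (if j = n then Pl i j else Mi i j)"

lemma flip_flip [simp]: "flip n (flip n r) = r"
  by (cases r) auto

lemma mem_flip_image: "r \<in> flip n ` I \<longleftrightarrow> flip n r \<in> I"
  by (metis flip_flip image_iff)

lemma flip_image_flip_image [simp]: "flip n ` flip n ` I = I"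
  by (auto simp: mem_flip_image)

lemma is_root_flip [simp]: "is_root n (flip n r) \<longleftrightarrow> is_root n r"
  by (cases r) auto

text \<open>The sign change of \<open>eps n\<close> permutes the simple roots, exchanging
  \<open>eps (n - 1) - eps n\<close> and \<open>eps (n - 1) + eps n\<close>.\<close>

lemma step_flip:
  "is_root n r \<Longrightarrow> is_root n s \<Longrightarrow> step n (flip n r) (flip n s) \<longleftrightarrow> step n r s"
  by (cases r; cases s) auto

lemma clash_flip:
  "is_root n r \<Longrightarrow> is_root n s \<Longrightarrow> clash (flip n r) (flip n s) \<longleftrightarrow> clash r s"
  by (cases r; cases s) auto

lemma flip_ideals:
  assumes "I \<in> ideals n"
  shows "flip n ` I \<in> ideals n"
proof -
  have root: "is_root n r" if "r \<in> I" for r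
    using that assms by (auto simp: ideals_def)
  have closed: "s \<in> I" if "r \<in> I" "is_root n s" "step n r s" for r s
    using that assms by (auto simp: ideals_def)
  have clash: "\<not> clash r s" if "r \<in> I" "s \<in> I" for r s
    using that assms by (auto simp: ideals_def)
  have "s \<in> flip n ` I" if "r \<in> I" "is_root n s" "step n (flip n r) s" for r s
    using closed[OF that(1), of "flip n s"] step_flip[of n r "flip n s"] root that
    by (simp add: mem_flip_image)
  moreover have "\<not> clash (flip n r) (flip n s)" if "r \<in> I" "s \<in> I" for r s
    using clash[OF that] clash_flip root that by simp
  ultimately show ?thesis
    using root by (auto simp: ideals_def)
qed

lemma kappa_flip:
  assumes "I \<in> ideals n"
  shows "kappa (ideals n) (flip n ` I) = kappa (ideals n) I"
    and "iota (ideals n) (flip n ` I) = iota (ideals n) I"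
proof -
  have image: "image (flip n) ` ideals n = ideals n"
    using flip_ideals by (force simp: image_iff intro: bexI[of _ "flip n ` _"])
  have mono: "flip n ` I \<le> flip n ` J \<longleftrightarrow> I \<le> J" for I J
    by (metis flip_image_flip_image image_mono)
  show "kappa (ideals n) (flip n ` I) = kappa (ideals n) I"
    using kappa_image[of "ideals n" "image (flip n)", OF mono assms] by (simp only: image)
  show "iota (ideals n) (flip n ` I) = iota (ideals n) I"
    using iota_image[of "ideals n" "image (flip n)", OF mono assms] by (simp only: image)
qed

section \<open>Explicit neighbours in the root order\<close>

lemma step_from_Pl:
  assumes "is_root n (Pl i j)"
  shows "(\<forall>s. is_root n s \<longrightarrow> step n (Pl i j) s \<longrightarrow> s \<in> I) \<longleftrightarrow>
    (1 < i \<longrightarrow> Pl (i - 1) j \<in> I) \<and> (Suc i < j \<longrightarrow> Pl i (j - 1) \<in> I)" (is "?l \<longleftrightarrow> ?r")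
proof
  assume ?l
  from this[rule_format, of "Pl (i - 1) j"] this[rule_format, of "Pl i (j - 1)"] assms
  show ?r by auto
next
  assume r: ?r
  show ?l
  proof (intro allI impI)
    fix s assume "is_root n s" "step n (Pl i j) s"
    with r show "s \<in> I" by (cases s) auto
  qed
qed

lemma step_from_Mi:
  assumes "is_root n (Mi i j)"
  shows "(\<forall>s. is_root n s \<longrightarrow> step n (Mi i j) s \<longrightarrow> s \<in> I) \<longleftrightarrow>
    (1 < i \<longrightarrow> Mi (i - 1) j \<in> I) \<and> (j < n \<longrightarrow> Mi i (Suc j) \<in> I) \<and>
    (j = n \<and> Suc i < n \<longrightarrow> Pl i (n - 1) \<in> I) \<and> (Suc j = n \<longrightarrow> Pl i n \<in> I)" (is "?l \<longleftrightarrow> ?r")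
proof
  assume ?l
  from this[rule_format, of "Mi (i - 1) j"] this[rule_format, of "Mi i (Suc j)"]
    this[rule_format, of "Pl i (n - 1)"] this[rule_format, of "Pl i n"] assms
  show ?r by auto
next
  assume r: ?r
  show ?l
  proof (intro allI impI)
    fix s assume "is_root n s" "step n (Mi i j) s"
    with r assms show "s \<in> I" by (cases s) auto
  qed
qed

lemma step_to_Pl:
  assumes "I \<subseteq> {r. is_root n r}"
  shows "(\<forall>s\<in>I. \<not> step n s (Pl i j)) \<longleftrightarrow> Pl (Suc i) j \<notin> I \<and> Pl i (Suc j) \<notin> I \<and>
    (Suc j = n \<longrightarrow> Mi i n \<notin> I) \<and> (j = n \<longrightarrow> Mi i (n - 1) \<notin> I)" (is "?l \<longleftrightarrow> ?r")
proof
  assume l: ?l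
  \<comment> \<open>The step from \<open>Mi i (n - 1)\<close> to \<open>Pl i n\<close> requires
    \<open>Suc (n - 1) = n\<close>, which truncated subtraction grants only for
    \<open>0 < n\<close>.\<close>
  have "Mi i (n - 1) \<in> I \<Longrightarrow> 0 < n"
    using subsetD[OF assms, of "Mi i (n - 1)"] by auto
  with l[rule_format, of "Pl (Suc i) j"] l[rule_format, of "Pl i (Suc j)"]
    l[rule_format, of "Mi i n"] l[rule_format, of "Mi i (n - 1)"]
  show ?r by auto
next
  assume r: ?r
  show ?l
  proof
    fix s assume "s \<in> I"
    with r show "\<not> step n s (Pl i j)" by (cases s) auto
  qed
qed

lemma step_to_Mi:
  assumes "1 \<le> j"
  shows "(\<forall>s\<in>I. \<not> step n s (Mi i j)) \<longleftrightarrow> Mi (Suc i) j \<notin> I \<and> Mi i (j - 1) \<notin> I" (is "?l \<longleftrightarrow> ?r")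
proof
  assume ?l
  from this[rule_format, of "Mi (Suc i) j"] this[rule_format, of "Mi i (j - 1)"] assms
  show ?r by auto
next
  assume r: ?r
  show ?l
  proof
    fix s assume "s \<in> I"
    with r show "\<not> step n s (Mi i j)" by (cases s) auto
  qed
qed

lemma idealsI:
  assumes "\<And>r. r \<in> I \<Longrightarrow> is_root n r"
    and "\<And>r s. r \<in> I \<Longrightarrow> is_root n s \<Longrightarrow> step n r s \<Longrightarrow> s \<in> I"
    and "\<And>r s. r \<in> I \<Longrightarrow> s \<in> I \<Longrightarrow> \<not> clash r s"
  shows "I \<in> ideals n"
  unfolding ideals_def
  by (intro CollectI conjI subsetI ballI allI impI) (fact assms)+

lemma idealsD:
  assumes "I \<in> ideals n"
  shows "r \<in> I \<Longrightarrow> is_root n r"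
    and "r \<in> I \<Longrightarrow> is_root n s \<Longrightarrow> step n r s \<Longrightarrow> s \<in> I"
    and "r \<in> I \<Longrightarrow> s \<in> I \<Longrightarrow> \<not> clash r s"
  using assms unfolding ideals_def by blast+

text \<open>First \<open>i\<close> is lowered to \<open>k\<close>, then \<open>j\<close> to
  \<open>l\<close>; in this order all intermediate pairs are valid codes, by
  \<open>k \<le> i < j\<close> and \<open>k < l\<close>.\<close>

lemma ideals_Pl_mono:
  assumes I: "I \<in> ideals n" and "Pl i j \<in> I" "1 \<le> k" "k \<le> i" "k < l" "l \<le> j"
  shows "Pl k l \<in> I"
proof -
  have root: "1 \<le> i" "i < j" "j \<le> n" using idealsD(1)[OF I assms(2)] by auto
  have "Pl k j \<in> I"
    using \<open>k \<le> i\<close>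
  proof (induction k rule: inc_induct)
    case (step m)
    then show ?case
      using idealsD(2)[OF I, of "Pl (Suc m) j" "Pl m j"] root \<open>1 \<le> k\<close> by auto
  qed fact
  show ?thesis
    using \<open>l \<le> j\<close>
  proof (induction l rule: inc_induct)
    case (step m)
    then show ?case
      using idealsD(2)[OF I, of "Pl k (Suc m)" "Pl k m"] root \<open>1 \<le> k\<close> \<open>k < l\<close> by auto
  qed fact
qed

lemma ideals_Mi_mono:
  assumes I: "I \<in> ideals n" and "Mi i j \<in> I" "1 \<le> k" "k \<le> i" "j \<le> l" "l \<le> n"
  shows "Mi k l \<in> I"
proof -
  have root: "1 \<le> i" "i < j" "j \<le> n" using idealsD(1)[OF I assms(2)] by auto
  have "Mi k j \<in> I"
    using \<open>k \<le> i\<close>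
  proof (induction k rule: inc_induct)
    case (step m)
    then show ?case
      using idealsD(2)[OF I, of "Mi (Suc m) j" "Mi m j"] root \<open>1 \<le> k\<close> by auto
  qed fact
  show ?thesis
    using \<open>j \<le> l\<close> \<open>l \<le> n\<close>
  proof (induction l rule: dec_induct)
    case base
    show ?case by fact
  next
    case (step m)
    then show ?case
      using idealsD(2)[OF I, of "Mi k m" "Mi k (Suc m)"] root \<open>1 \<le> k\<close> \<open>k \<le> i\<close> by auto
  qed
qed

lemma plus_roots_ideals:
  assumes "J \<in> shapes 1 n"
  shows "plus_roots J \<in> ideals n"
proof (rule idealsI)
  fix r assume "r \<in> plus_roots J"
  then show "is_root n r"
    by (cases r) (auto dest: shapesD(1)[OF assms])
next
  fix r s assume "r \<in> plus_roots J" "is_root n s" "step n r s"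
  then show "s \<in> plus_roots J"
    using shapesD(2)[OF assms] by (cases r; cases s) force+
next
  fix r s assume "r \<in> plus_roots J" "s \<in> plus_roots J"
  then show "\<not> clash r s" by (cases r; cases s) auto
qed

text \<open>The roots \<open>eps 1 - eps j\<close> with \<open>b \<le> j\<close> share no index with
  \<open>J\<close>, and adding \<open>eps 1 + eps j\<close> gives twice \<open>eps 1\<close>, not a
  root. Roots directly above \<open>J\<close> but outside it lie in row 1.\<close>

lemma fan_ideals:
  assumes J: "J \<in> shapes 2 (b - 1)" and b: "2 \<le> b" "b \<le> n"
  shows "fan n b J \<in> ideals n"
proof (rule idealsI)
  fix r assume "r \<in> fan n b J"
  then show "is_root n r"
    using b by (cases r) (auto dest: shapesD(1)[OF J])
next
  fix r s assume rs: "r \<in> fan n b J" "is_root n s" "step n r s"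
  show "s \<in> fan n b J"
  proof (cases r)
    case (Pl i j)
    then show ?thesis
      using rs shapesD(1)[OF J, of i j] shapesD(2)[OF J, of i j "i - 1" j] shapesD(2)[OF J, of i j i "j - 1"] b
      by (cases s; cases "2 \<le> i - 1") auto
  next
    case (Mi i j)
    then show ?thesis using rs b by (cases s) auto
  qed
next
  fix r s assume "r \<in> fan n b J" "s \<in> fan n b J"
  then show "\<not> clash r s"
    using b by (cases r; cases s) (auto dest: shapesD(1)[OF J])
qed

text \<open>\<open>eps 1 - eps n\<close> lies above every \<open>eps i - eps j\<close>, so its
  absence excludes them all.\<close>

lemma ideals_without_minus:
  assumes I: "I \<in> ideals n" and "Mi 1 n \<notin> I"
  shows "\<exists>J\<in>shapes 1 n. I = plus_roots J"
proof -
  let ?J = "{(i, j). Pl i j \<in> I}"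
  have "Mi i j \<notin> I" for i j
    using ideals_Mi_mono[OF I, of i j 1 n] idealsD(1)[OF I, of "Mi i j"] assms(2) by auto
  then have "r \<in> I \<longleftrightarrow> r \<in> plus_roots ?J" for r by (cases r) auto
  moreover have "?J \<in> shapes 1 n"
  proof (rule shapesI)
    fix i j assume "(i, j) \<in> ?J"
    then show "1 \<le> i \<and> i < j \<and> j \<le> n" using idealsD(1)[OF I, of "Pl i j"] by auto
  next
    fix i j k l assume "(i, j) \<in> ?J" "1 \<le> k" "k \<le> i" "k < l" "l \<le> j"
    then show "(k, l) \<in> ?J" using ideals_Pl_mono[OF I, of i j k l] by simp
  qed
  ultimately show ?thesis by blast
qed

text \<open>Two clashes fix the form. For \<open>i \<noteq> 1\<close>, \<open>eps 1 + eps n\<close>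
  excludes \<open>eps i - eps n\<close> and so, by up-closure, every \<open>eps i - eps j\<close>.
  For \<open>b \<le> j\<close>, \<open>eps 1 - eps j\<close> excludes \<open>eps i + eps j\<close>
  with \<open>i \<noteq> 1\<close>, which bounds \<open>J\<close>.\<close>

lemma ideals_with_both:
  assumes I: "I \<in> ideals n" and "Mi 1 n \<in> I" "Pl 1 n \<in> I"
  shows "\<exists>b J. 2 \<le> b \<and> b \<le> n \<and> J \<in> shapes 2 (b - 1) \<and> I = fan n b J"
proof -
  define b where "b = (LEAST b. Mi 1 b \<in> I)"
  have b: "Mi 1 b \<in> I" unfolding b_def by (rule LeastI) fact
  have b_le: "b \<le> j" if "Mi 1 j \<in> I" for j unfolding b_def using that by (rule Least_le)
  have b2: "2 \<le> b" "b \<le> n" using idealsD(1)[OF I b] by auto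
  have first: "i = 1" if ij: "Mi i j \<in> I" for i j
  proof (rule ccontr)
    assume "i \<noteq> 1"
    have root: "1 \<le> i" "i < j" "j \<le> n" using idealsD(1)[OF I ij] by auto
    have "Mi i n \<in> I" using ideals_Mi_mono[OF I ij, of i n] root by simp
    with idealsD(3)[OF I this \<open>Pl 1 n \<in> I\<close>] \<open>i \<noteq> 1\<close> show False by simp
  qed
  let ?J = "{(i, j). Pl i j \<in> I \<and> i \<noteq> 1}"
  have "?J \<in> shapes 2 (b - 1)"
  proof (rule shapesI)
    fix i j assume "(i, j) \<in> ?J"
    then have ij: "Pl i j \<in> I" "i \<noteq> 1" by auto
    have root: "1 \<le> i" "i < j" "j \<le> n" using idealsD(1)[OF I ij(1)] by auto
    have "\<not> b \<le> j"
    proof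
      assume "b \<le> j"
      then have "Mi 1 j \<in> I" using ideals_Mi_mono[OF I b, of 1 j] root by simp
      with idealsD(3)[OF I this ij(1)] ij(2) show False by simp
    qed
    with root ij(2) show "2 \<le> i \<and> i < j \<and> j \<le> b - 1" by auto
  next
    fix i j k l assume "(i, j) \<in> ?J" "2 \<le> k" "k \<le> i" "k < l" "l \<le> j"
    then show "(k, l) \<in> ?J" using ideals_Pl_mono[OF I, of i j k l] by simp
  qed
  moreover have "r \<in> I \<longleftrightarrow> r \<in> fan n b ?J" for r
  proof (cases r)
    case (Pl i j)
    then show ?thesis
      using ideals_Pl_mono[OF I \<open>Pl 1 n \<in> I\<close>, of 1 j] idealsD(1)[OF I, of r] by auto
  next
    case (Mi i j)
    then show ?thesis
      using first[of i j] b_le[of j] ideals_Mi_mono[OF I b, of 1 j] idealsD(1)[OF I, of r] by auto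
  qed
  ultimately show ?thesis using b2 by blast
qed

section \<open>Coverings of each type of abelian ideal\<close>

text \<open>The four families are told apart by \<open>Pl 1 n\<close> and \<open>Mi 1 n\<close>:
  neither, only the first, only the second, both.\<close>

lemma ideals_decompose:
  assumes "2 \<le> n"
  shows "ideals n = plus_roots ` shapes 1 (n - 1)
     \<union> (plus_roots ` {J \<in> shapes 1 n. (1, n) \<in> J}
     \<union> (image (flip n) ` plus_roots ` {J \<in> shapes 1 n. (1, n) \<in> J}
     \<union> (\<Union>b\<in>{2..n}. fan n b ` shapes 2 (b - 1))))"
    (is "_ = ?P0 \<union> (?P1 \<union> (?P2 \<union> ?P3))")
proof (intro subset_antisym subsetI)
  have tip: "{J \<in> shapes 1 n. (1, n) \<notin> J} = shapes 1 (n - 1)"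
    using shapes_without_tip[of 1 "n - 1"] assms by simp
  fix I assume I: "I \<in> ideals n"
  consider "Mi 1 n \<notin> I" | "Mi 1 n \<in> I" "Pl 1 n \<notin> I" | "Mi 1 n \<in> I" "Pl 1 n \<in> I" by blast
  then show "I \<in> ?P0 \<union> (?P1 \<union> (?P2 \<union> ?P3))"
  proof cases
    case 1
    then obtain J where "J \<in> shapes 1 n" "I = plus_roots J"
      using ideals_without_minus[OF I] by blast
    then show ?thesis unfolding tip[symmetric] by blast
  next
    case 2
    have "Mi 1 n \<notin> flip n ` I" "Pl 1 n \<in> flip n ` I"
      using 2 by (simp_all add: mem_flip_image)
    then obtain J where "J \<in> shapes 1 n" "flip n ` I = plus_roots J" "(1, n) \<in> J"
      using ideals_without_minus[OF flip_ideals[OF I]] by (metis mem_plus_roots(1))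
    moreover from this have "I = flip n ` plus_roots J"
      by (metis flip_image_flip_image)
    ultimately show ?thesis by blast
  next
    case 3
    then obtain b J where "b \<in> {2..n}" "J \<in> shapes 2 (b - 1)" "I = fan n b J"
      using ideals_with_both[OF I] by auto
    then show ?thesis by blast
  qed
next
  have sub: "shapes 1 (n - 1) \<subseteq> shapes 1 n"
    using shapes_subset_Suc[of 1 "n - 1"] assms by simp
  fix I assume "I \<in> ?P0 \<union> (?P1 \<union> (?P2 \<union> ?P3))"
  then show "I \<in> ideals n"
    using sub plus_roots_ideals flip_ideals fan_ideals by fastforce
qed

lemma inj_fan: "inj_on (fan n b) (shapes 2 (b - 1))"
proof (rule inj_onI)
  fix J J' assume J: "J \<in> shapes 2 (b - 1)" "J' \<in> shapes 2 (b - 1)" "fan n b J = fan n b J'"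
  have "(i, j) \<in> J \<longleftrightarrow> (i, j) \<in> J'" for i j
    using J(3)[THEN eqset_imp_iff, of "Pl i j"] shapesD(1)[OF J(1), of i j] shapesD(1)[OF J(2), of i j]
    by auto
  then show "J = J'" by auto
qed

text \<open>The two top roots separate the four families, and the least \<open>j\<close> with
  \<open>Mi 1 j\<close> present separates the fans. The flipped family contributes as much as the
  unflipped one, whence the factor 2.\<close>

lemma sum_ideals:
  fixes f :: "root set \<Rightarrow> int fps"
  assumes n: "2 \<le> n" and flip: "\<And>I. I \<in> ideals n \<Longrightarrow> f (flip n ` I) = f I"
  shows "(\<Sum>I\<in>ideals n. f I) =
    (\<Sum>J\<in>shapes 1 (n - 1). f (plus_roots J)) +
    2 * (\<Sum>J | J \<in> shapes 1 n \<and> (1, n) \<in> J. f (plus_roots J)) +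
    (\<Sum>b\<in>{2..n}. \<Sum>J\<in>shapes 2 (b - 1). f (fan n b J))"
proof -
  let ?S1 = "{J \<in> shapes 1 n. (1, n) \<in> J}"
  let ?P0 = "plus_roots ` shapes 1 (n - 1)" and ?P1 = "plus_roots ` ?S1"
  let ?P2 = "image (flip n) ` ?P1" and ?P3 = "\<Union>b\<in>{2..n}. fan n b ` shapes 2 (b - 1)"
  have P0: "Pl 1 n \<notin> I \<and> Mi 1 n \<notin> I" if "I \<in> ?P0" for I
    using that n by (auto dest: shapesD(1))
  have P1: "Pl 1 n \<in> I \<and> Mi 1 n \<notin> I" if "I \<in> ?P1" for I
    using that by auto
  have P2: "Pl 1 n \<notin> I \<and> Mi 1 n \<in> I" if "I \<in> ?P2" for I
  proof -
    from that obtain J where "(1, n) \<in> J" "I = flip n ` plus_roots J" by blast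
    then show ?thesis by (simp add: mem_flip_image)
  qed
  have P3: "Pl 1 n \<in> I \<and> Mi 1 n \<in> I" if "I \<in> ?P3" for I
    using that n by auto
  have disj: "?P0 \<inter> (?P1 \<union> (?P2 \<union> ?P3)) = {}" "?P1 \<inter> (?P2 \<union> ?P3) = {}" "?P2 \<inter> ?P3 = {}"
  proof -
    have disjI: "A \<inter> B = {}" if "\<And>I. I \<in> A \<Longrightarrow> Q I" "\<And>I. I \<in> B \<Longrightarrow> \<not> Q I"
      for A B :: "root set set" and Q
      using that by blast
    show "?P0 \<inter> (?P1 \<union> (?P2 \<union> ?P3)) = {}"
      by (rule disjI[where Q = "\<lambda>I. Pl 1 n \<notin> I \<and> Mi 1 n \<notin> I"], erule P0, elim UnE;
          (drule P1 | drule P2 | drule P3); simp)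
    show "?P1 \<inter> (?P2 \<union> ?P3) = {}"
      by (rule disjI[where Q = "\<lambda>I. Mi 1 n \<notin> I"], drule P1, simp, elim UnE;
          (drule P2 | drule P3); simp)
    show "?P2 \<inter> ?P3 = {}"
      by (rule disjI[where Q = "\<lambda>I. Pl 1 n \<notin> I"], drule P2, simp, drule P3, simp)
  qed
  have fin: "finite ?P0" "finite ?P1" "finite ?P2" "finite ?P3"
    using finite_shapes by auto
  have "(\<Sum>I\<in>ideals n. f I) = sum f ?P0 + (sum f ?P1 + (sum f ?P2 + sum f ?P3))"
    unfolding ideals_decompose[OF n] using fin disj by (simp only: sum.union_disjoint finite_Un)
  moreover have "sum f ?P0 = (\<Sum>J\<in>shapes 1 (n - 1). f (plus_roots J))"
    by (subst sum.reindex) (auto intro: inj_on_subset[OF inj_plus_roots])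
  moreover have "sum f ?P1 = (\<Sum>J\<in>?S1. f (plus_roots J))"
    by (subst sum.reindex) (auto intro: inj_on_subset[OF inj_plus_roots])
  moreover have "sum f ?P2 = sum f ?P1"
  proof -
    have "inj_on (image (flip n)) ?P1"
      by (rule inj_onI) (metis flip_image_flip_image)
    then have "sum f ?P2 = (\<Sum>I\<in>?P1. f (flip n ` I))"
      by (simp only: sum.reindex o_def)
    also have "\<dots> = sum f ?P1"
      by (intro sum.cong refl flip) (auto intro: plus_roots_ideals)
    finally show ?thesis .
  qed
  moreover have "sum f ?P3 = (\<Sum>b\<in>{2..n}. \<Sum>J\<in>shapes 2 (b - 1). f (fan n b J))"
  proof -
    have "fan n b ` shapes 2 (b - 1) \<inter> fan n c ` shapes 2 (c - 1) = {}"
      if bc: "b \<in> {2..n}" "c \<in> {2..n}" "b \<noteq> c" for b c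
    proof (intro equals0I, elim IntE imageE)
      fix I J K assume "I = fan n b J" "I = fan n c K"
      then have "Mi 1 b \<in> fan n c K" "Mi 1 c \<in> fan n b J" using bc by (metis mem_fan(2) atLeastAtMost_iff order_refl)+
      with bc show False by simp
    qed
    then have "sum f ?P3 = (\<Sum>b\<in>{2..n}. sum f (fan n b ` shapes 2 (b - 1)))"
      using finite_shapes by (intro sum.UNION_disjoint) auto
    then show ?thesis by (simp only: sum.reindex[OF inj_fan] o_def)
  qed
  ultimately show ?thesis by (simp add: algebra_simps)
qed

lemma kappa_plus_roots:
  assumes J: "J \<in> shapes 1 n"
  shows "kappa (ideals n) (plus_roots J) = card (corners J)"
proof -
  have I: "plus_roots J \<in> ideals n" by (rule plus_roots_ideals[OF J])
  then have roots: "plus_roots J \<subseteq> {r. is_root n r}" by (auto simp: ideals_def)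
  have "r \<in> plus_roots J \<and> (\<forall>s\<in>plus_roots J. \<not> step n s r) \<longleftrightarrow> r \<in> plus_roots (corners J)" for r
    by (cases r) (auto simp: step_to_Pl[OF roots] corners_def)
  then show ?thesis unfolding kappa_ideals[OF I] by simp
qed

text \<open>The minimal minus root is \<open>eps 1 - eps b\<close>. In row 1 only
  \<open>eps 1 + eps n\<close> can be minimal, and for \<open>b < n\<close> the member
  \<open>eps 1 - eps (n - 1)\<close> lies directly below it.\<close>

lemma kappa_fan:
  assumes J: "J \<in> shapes 2 (b - 1)" and b: "2 \<le> b" "b \<le> n"
  shows "kappa (ideals n) (fan n b J) = card (corners J) + (if b = n then 2 else 1)"
proof -
  have I: "fan n b J \<in> ideals n" by (rule fan_ideals[OF J b])
  then have roots: "fan n b J \<subseteq> {r. is_root n r}" by (auto simp: ideals_def)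
  have J_bound: "2 \<le> i \<and> i < j \<and> j < b" if "(i, j) \<in> J" for i j
    using shapesD(1)[OF J that] by auto
  have "r \<in> fan n b J \<and> (\<forall>s\<in>fan n b J. \<not> step n s r) \<longleftrightarrow>
      r \<in> plus_roots (corners J) \<union> insert (Mi 1 b) (if b = n then {Pl 1 n} else {})" for r
  proof (cases r)
    case (Pl i j)
    show ?thesis
      unfolding Pl step_to_Pl[OF roots]
      using b J_bound[of i j] J_bound[of "Suc i" j] J_bound[of i "Suc j"]
      by (cases "i = 1"; cases "j = n") (auto simp: corners_def)
  next
    case (Mi i j)
    show ?thesis
    proof (cases "1 \<le> j")
      case True
      show ?thesis unfolding Mi step_to_Mi[OF True] using b by auto
    next
      case False
      then show ?thesis using Mi b by auto
    qed
  qed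
  then have "kappa (ideals n) (fan n b J) =
      card (plus_roots (corners J) \<union> insert (Mi 1 b) (if b = n then {Pl 1 n} else {}))"
    unfolding kappa_ideals[OF I] by (intro arg_cong[where f = card]) blast
  moreover have "(1, n) \<notin> corners J" using J_bound[of 1 n] by (auto simp: corners_def)
  then have "card (plus_roots (corners J) \<union> insert (Mi 1 b) (if b = n then {Pl 1 n} else {})) =
      card (corners J) + (if b = n then 2 else 1)"
    by (subst card_Un_disjoint) (auto simp: finite_corners[OF J])
  ultimately show ?thesis by simp
qed

lemma iota_eqI:
  assumes "I \<in> ideals n"
    and "\<And>i j. 1 \<le> i \<Longrightarrow> i < j \<Longrightarrow> j \<le> n \<Longrightarrow> Pl i j \<in> A \<longleftrightarrow> Pl i j \<notin> I \<and>
      (1 < i \<longrightarrow> Pl (i - 1) j \<in> I) \<and> (Suc i < j \<longrightarrow> Pl i (j - 1) \<in> I) \<and> (\<forall>s\<in>I. \<not> clash (Pl i j) s)"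
    and "\<And>i j. 1 \<le> i \<Longrightarrow> i < j \<Longrightarrow> j \<le> n \<Longrightarrow> Mi i j \<in> A \<longleftrightarrow> Mi i j \<notin> I \<and>
      (1 < i \<longrightarrow> Mi (i - 1) j \<in> I) \<and> (j < n \<longrightarrow> Mi i (Suc j) \<in> I) \<and>
      (j = n \<and> Suc i < n \<longrightarrow> Pl i (n - 1) \<in> I) \<and> (Suc j = n \<longrightarrow> Pl i n \<in> I) \<and> (\<forall>s\<in>I. \<not> clash (Mi i j) s)"
    and "A \<subseteq> {r. is_root n r}"
  shows "iota (ideals n) I = card A"
proof -
  have "r \<in> A \<longleftrightarrow> is_root n r \<and> r \<notin> I \<and>
    (\<forall>s. is_root n s \<longrightarrow> step n r s \<longrightarrow> s \<in> I) \<and> (\<forall>s\<in>I. \<not> clash r s)" for r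
  proof (cases "is_root n r")
    case True
    then show ?thesis
    proof (cases r)
      case (Pl i j)
      with True show ?thesis by (simp add: step_from_Pl assms(2))
    next
      case (Mi i j)
      with True show ?thesis by (simp add: step_from_Mi assms(3))
    qed
  qed (use assms(4) in auto)
  then show ?thesis unfolding iota_ideals[OF assms(1)] by (intro arg_cong[where f = card]) blast
qed

lemma ball_root: "(\<forall>s\<in>I. Q s) \<longleftrightarrow> (\<forall>c d. Pl c d \<in> I \<longrightarrow> Q (Pl c d)) \<and> (\<forall>c d. Mi c d \<in> I \<longrightarrow> Q (Mi c d))"
  by (metis root.exhaust)

text \<open>\<open>Pl 1 n\<close> and \<open>Mi 1 n\<close> both have \<open>Pl 1 (n - 1)\<close> as
  their only cover, and index \<open>n\<close> does not occur in \<open>J\<close>, so no clash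
  prevents adding either.\<close>

lemma iota_plus_roots_without_tip:
  assumes J: "J \<in> shapes 1 (n - 1)" and n: "3 \<le> n"
  shows "iota (ideals n) (plus_roots J) =
    card (gaps 1 (n - 1) J) + (if (1, n - 1) \<in> J then 2 else 0)"
proof -
  have J_bound: "1 \<le> i \<and> i < j \<and> j < n" if "(i, j) \<in> J" for i j
    using shapesD(1)[OF J that] n by auto
  have "J \<in> shapes 1 n"
    using subsetD[OF shapes_subset_Suc[of 1 "n - 1"] J] n by simp
  then have I: "plus_roots J \<in> ideals n" by (rule plus_roots_ideals)
  have "iota (ideals n) (plus_roots J) =
      card (plus_roots (gaps 1 (n - 1) J) \<union> (if (1, n - 1) \<in> J then {Pl 1 n, Mi 1 n} else {}))"
  proof (rule iota_eqI[OF I], goal_cases)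
    case (1 i j)
    then show ?case
      using n J_bound[of i j] J_bound[of "i - 1" j]
      by (cases "j = n") (auto simp: gaps_def ball_root)
  next
    case (2 i j)
    then show ?case
      using n by (auto simp: ball_root dest: J_bound)
  next
    case 3
    show ?case
      using n by (auto simp: gaps_def plus_roots_def)
  qed
  also have "\<dots> = card (gaps 1 (n - 1) J) + (if (1, n - 1) \<in> J then 2 else 0)"
  proof -
    have "(1, n) \<notin> gaps 1 (n - 1) J" using n by (auto simp: gaps_def)
    then show ?thesis
      by (subst card_Un_disjoint) (auto simp: finite_gaps)
  qed
  finally show ?thesis .
qed

text \<open>Besides the gaps only \<open>Mi 1 n\<close> is a candidate. It clashes with the roots
  \<open>eps c + eps n\<close> for \<open>c \<ge> 2\<close>, and by closure one of them is present
  exactly when \<open>(2, n)\<close> is.\<close>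

lemma iota_plus_roots_with_tip:
  assumes J: "J \<in> shapes 1 n" "(1, n) \<in> J" and n: "3 \<le> n"
  shows "iota (ideals n) (plus_roots J) = card (gaps 1 n J) + (if (2, n) \<in> J then 0 else 1)"
proof -
  have I: "plus_roots J \<in> ideals n" by (rule plus_roots_ideals[OF J(1)])
  have J_bound: "1 \<le> i \<and> i < j \<and> j \<le> n" if "(i, j) \<in> J" for i j
    using shapesD(1)[OF J(1) that] by auto
  have tip: "(1, n - 1) \<in> J"
    using shapesD(2)[OF J, of 1 "n - 1"] n by auto
  have second: "(2, n) \<in> J" if "(c, n) \<in> J" "c \<noteq> 1" for c
    using shapesD(2)[OF J(1) that(1), of 2 n] J_bound[OF that(1)] that(2) n by auto
  have clash: "(\<forall>s\<in>plus_roots J. \<not> clash (Mi 1 n) s) \<longleftrightarrow> (2, n) \<notin> J"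
  proof
    assume "\<forall>s\<in>plus_roots J. \<not> clash (Mi 1 n) s"
    from this[rule_format, of "Pl 2 n"] show "(2, n) \<notin> J" by auto
  next
    assume "(2, n) \<notin> J"
    then have "\<not> clash (Mi 1 n) (Pl c d)" if "(c, d) \<in> J" for c d
      using that second[of c] J_bound[of c d] by auto
    then show "\<forall>s\<in>plus_roots J. \<not> clash (Mi 1 n) s"
      by (simp only: ball_root mem_plus_roots) blast
  qed
  have "iota (ideals n) (plus_roots J) =
      card (plus_roots (gaps 1 n J) \<union> (if (2, n) \<in> J then {} else {Mi 1 n}))"
  proof (rule iota_eqI[OF I], goal_cases)
    case (1 i j)
    then show ?case
      by (auto simp: gaps_def ball_root)
  next
    case (2 i j)
    then show ?case
      using tip by (cases "i = 1"; cases "j = n") (simp_all add: clash[simplified])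
  next
    case 3
    show ?case
      using n by (auto simp: gaps_def plus_roots_def)
  qed
  also have "\<dots> = card (gaps 1 n J) + (if (2, n) \<in> J then 0 else 1)"
    by (subst card_Un_disjoint) (auto simp: finite_gaps)
  finally show ?thesis .
qed

text \<open>For \<open>i \<ge> 2\<close> and \<open>j \<ge> b\<close>, \<open>Pl i j\<close> clashes
  with \<open>Mi 1 j\<close>, so plus roots can be added only at gaps of \<open>J\<close>. The only
  minus candidate is \<open>Mi 1 (b - 1)\<close>; it is a root for \<open>b > 2\<close> and clashes
  with the last column of \<open>J\<close>.\<close>

lemma iota_fan:
  assumes J: "J \<in> shapes 2 (b - 1)" and b: "2 \<le> b" "b \<le> n"
  shows "iota (ideals n) (fan n b J) =
    card (gaps 2 (b - 1) J) + (if b = 2 \<or> (2, b - 1) \<in> J then 0 else 1)"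
proof -
  have I: "fan n b J \<in> ideals n" by (rule fan_ideals[OF J b])
  have J_bound: "2 \<le> i \<and> i < j \<and> j < b" if "(i, j) \<in> J" for i j
    using shapesD(1)[OF J that] by auto
  have second: "(2, b - 1) \<in> J" if "(c, b - 1) \<in> J" for c
    using shapesD(2)[OF J that, of 2 "b - 1"] J_bound[OF that] by auto
  have clash: "(\<forall>s\<in>fan n b J. \<not> clash (Mi 1 (b - 1)) s) \<longleftrightarrow> (2, b - 1) \<notin> J" if "2 < b"
  proof
    assume "\<forall>s\<in>fan n b J. \<not> clash (Mi 1 (b - 1)) s"
    from this[rule_format, of "Pl 2 (b - 1)"] show "(2, b - 1) \<notin> J" by auto
  next
    assume tip: "(2, b - 1) \<notin> J"
    have "\<not> clash (Mi 1 (b - 1)) (Pl c d)" if "Pl c d \<in> fan n b J" for c d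
      using that tip second[of c] J_bound[of c d] \<open>2 < b\<close> by auto
    moreover have "\<not> clash (Mi 1 (b - 1)) (Mi c d)" if "Mi c d \<in> fan n b J" for c d
      using that \<open>2 < b\<close> by auto
    ultimately show "\<forall>s\<in>fan n b J. \<not> clash (Mi 1 (b - 1)) s"
      by (simp only: ball_root) blast
  qed
  have "iota (ideals n) (fan n b J) =
      card (plus_roots (gaps 2 (b - 1) J) \<union> (if b = 2 \<or> (2, b - 1) \<in> J then {} else {Mi 1 (b - 1)}))"
  proof (rule iota_eqI[OF I], goal_cases)
    case (1 i j)
    show ?case
    proof (cases "i = 1")
      case True
      with 1 show ?thesis by (auto simp: gaps_def)
    next
      case False
      have clash_Pl: "(\<forall>s\<in>fan n b J. \<not> clash (Pl i j) s) \<longleftrightarrow> j < b"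
      proof
        assume "\<forall>s\<in>fan n b J. \<not> clash (Pl i j) s"
        from this[rule_format, of "Mi 1 j"] 1 False have "\<not> b \<le> j" by auto
        then show "j < b" by simp
      qed (use 1 False in \<open>auto simp: ball_root\<close>)
      show ?thesis
        unfolding clash_Pl using 1 False b by (cases "i = 2") (auto simp: gaps_def)
    qed
  next
    case (2 i j)
    show ?case
    proof (cases "i = 1")
      case True
      show ?thesis
      proof (cases "j = b - 1")
        case True
        with 2 have "2 < b" by simp
        show ?thesis
          unfolding True \<open>i = 1\<close> clash[OF \<open>2 < b\<close>] using b \<open>2 < b\<close> by auto
      next
        case False
        with 2 b \<open>i = 1\<close> show ?thesis by simp linarith
      qed
    next
      case False
      \<comment> \<open>The sum is the root \<open>eps 1 + eps i\<close>, as
        \<open>i \<noteq> 1\<close>.\<close>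
      have "clash (Mi i j) (Pl 1 j)" "Pl 1 j \<in> fan n b J"
        using 2 False by auto
      then have "\<not> (\<forall>s\<in>fan n b J. \<not> clash (Mi i j) s)" by blast
      with False show ?thesis by simp
    qed
  next
    case 3
    show ?case
      using b by (auto simp: gaps_def plus_roots_def)
  qed
  also have "\<dots> = card (gaps 2 (b - 1) J) + (if b = 2 \<or> (2, b - 1) \<in> J then 0 else 1)"
    by (subst card_Un_disjoint) (auto simp: finite_gaps)
  finally show ?thesis .
qed

section \<open>Generating functions\<close>

lemma fps_covering_polys:
  "fps_of_poly (upper_covering_poly P) = (\<Sum>x\<in>P. fps_X ^ kappa P x)"
  "fps_of_poly (lower_covering_poly P) = (\<Sum>x\<in>P. fps_X ^ iota P x)"
  by (simp_all add: upper_covering_poly_def lower_covering_poly_def fps_of_poly_sum fps_of_poly_monom)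

lemma corner_gf_total:
  "(\<Sum>J\<in>shapes a (a + m). fps_X ^ card (corners J)) = gf (Suc m) 0"
  by (subst sum_shapes_split[where P = "\<lambda>J. (a, a + m) \<in> J"]) (simp add: corner_gf gf_Suc)

text \<open>The exponents \<open>p\<close> and \<open>q\<close> account for addable roots outside
  the staircase, which depend on the tip alone.\<close>

lemma gap_gf_weighted:
  assumes "a \<le> b"
  shows "(\<Sum>J\<in>shapes a b. fps_X ^ (card (gaps a b J) + (if a = b \<or> (a, b) \<in> J then p else q))) =
     fps_X ^ p * gf (b - a) 0 + fps_X ^ q * gf (b - a) (- 1)"
proof -
  obtain m where b: "b = a + m" using assms by (metis le_iff_add)
  have "(\<Sum>J\<in>shapes a (a + m).
      fps_X ^ (card (gaps a (a + m) J) + (if m = 0 \<or> (a, a + m) \<in> J then p else q))) =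
     fps_X ^ p * gf m 0 + fps_X ^ q * gf m (- 1)"
    unfolding sum_shapes_split[where P = "\<lambda>J. m = 0 \<or> (a, a + m) \<in> J"]
      gap_gf[of a, symmetric] sum_distrib_left
    by (intro arg_cong2[where f = "(+)"] sum.cong) (auto simp: power_add mult.commute)
  then show ?thesis by (simp add: b)
qed

lemma fan_corner_gf:
  assumes "2 \<le> b"
  shows "(\<Sum>J\<in>shapes 2 (b - 1). fps_X ^ card (corners J)) = gf (b - 2) 0"
proof (cases "b = 2")
  case True
  then show ?thesis by (simp add: shapes_trivial corners_def gf_0)
next
  case False
  with assms obtain m where "b = m + 3" by (metis add.commute le_neq_implies_less le_iff_add Suc_leI eval_nat_numeral(3))
  then show ?thesis using corner_gf_total[of 2 m] by (simp add: numeral_eq_Suc)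
qed

text \<open>For \<open>b = 3\<close> the range is a single index. There
  \<open>gap_gf_weighted\<close> would treat the empty shape as containing its tip, whereas
  \<open>Mi 1 2\<close> is addable; hence the separate value.\<close>

lemma fan_gap_gf:
  assumes "3 \<le> b"
  shows "(\<Sum>J\<in>shapes 2 (b - 1).
      fps_X ^ (card (gaps 2 (b - 1) J) + (if b = 2 \<or> (2, b - 1) \<in> J then 0 else 1))) =
    (if b = 3 then fps_X else gf (b - 3) 0 + fps_X * gf (b - 3) (- 1))"
proof (cases "b = 3")
  case True
  have "gaps 2 2 {} = {}" by (auto simp: gaps_def)
  then show ?thesis using True by (simp add: shapes_trivial)
next
  case False
  with assms have b: "2 \<le> b - 1" "2 = b - 1 \<longleftrightarrow> False" "b = 2 \<longleftrightarrow> False" "b - 1 - 2 = b - 3"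
    by auto
  show ?thesis
    using gap_gf_weighted[OF b(1), of 0 1] False unfolding b by simp
qed

text \<open>The sum telescopes:
  \<open>fps_X * gf j 0 = gf j (- 2) = gf (Suc j) (- 1) - gf j (- 1)\<close>, and
  \<open>gf 0 (- 1) = 0\<close>.\<close>

lemma sum_fan_corner_gf: "(\<Sum>b\<in>{2..Suc m}. fps_X * gf (b - 2) 0) = gf m (- 1)"
proof (induction m)
  case 0
  show ?case by (simp add: gf_0)
next
  case (Suc m)
  then show ?case by (simp add: gf_Suc X_mult_gf)
qed

text \<open>The fans \<open>b = 2\<close> and \<open>b = 3\<close> give \<open>1 + fps_X\<close>;
  each later summand is the increment of the right side under Pascal's rule.\<close>

lemma sum_fan_gap_gf:
  "(\<Sum>b\<in>{2..Suc (Suc (Suc p))}. \<Sum>J\<in>shapes 2 (b - 1).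
      fps_X ^ (card (gaps 2 (b - 1) J) + (if b = 2 \<or> (2, b - 1) \<in> J then 0 else 1))) =
    gf (Suc p) 1 + fps_X * gf (Suc p) 0" (is "sum ?f _ = _")
proof (induction p)
  case 0
  have "gaps 2 1 {} = {}" by (auto simp: gaps_def)
  then have "?f 2 = 1" by (simp add: shapes_trivial)
  moreover have "?f 3 = fps_X" by (subst fan_gap_gf) simp_all
  moreover have "{2..Suc (Suc (Suc 0))} = {2, 3}" by auto
  ultimately show ?case by (simp add: gf_Suc gf_0)
next
  case (Suc p)
  have "?f (Suc (Suc (Suc (Suc p)))) = gf (Suc p) 0 + fps_X * gf (Suc p) (- 1)"
    by (subst fan_gap_gf) simp_all
  moreover have "{2..Suc (Suc (Suc (Suc p)))} = insert (Suc (Suc (Suc (Suc p)))) {2..Suc (Suc (Suc p))}"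
    by auto
  ultimately have "sum ?f {2..Suc (Suc (Suc (Suc p)))} =
      gf (Suc p) 0 + fps_X * gf (Suc p) (- 1) + (gf (Suc p) 1 + fps_X * gf (Suc p) 0)"
    using Suc.IH by simp
  also have "\<dots> = gf (Suc (Suc p)) 1 + fps_X * gf (Suc (Suc p)) 0"
    by (simp add: gf_Suc[of "Suc p"] algebra_simps)
  finally show ?case .
qed

section \<open>The covering polynomials and the deviation\<close>

lemma upper_gf:
  assumes n: "n = Suc (Suc m)"
  shows "fps_of_poly (upper_covering_poly (ideals n)) =
    gf (Suc m) 0 + 2 * gf (Suc m) (- 1) + gf m (- 1) + gf m (- 4)"
proof -
  have K0: "(\<Sum>J\<in>shapes 1 (n - 1). fps_X ^ kappa (ideals n) (plus_roots J)) = gf (Suc m) 0"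
  proof -
    have "shapes 1 (n - 1) \<subseteq> shapes 1 n" using shapes_subset_Suc[of 1 "Suc m"] n by simp
    then have "(\<Sum>J\<in>shapes 1 (n - 1). fps_X ^ kappa (ideals n) (plus_roots J)) =
      (\<Sum>J\<in>shapes 1 (1 + m). fps_X ^ card (corners J) :: int fps)"
      using n by (intro sum.cong) (auto simp: kappa_plus_roots subset_iff)
    then show ?thesis by (simp only: corner_gf_total)
  qed
  have K1: "(\<Sum>J | J \<in> shapes 1 n \<and> (1, n) \<in> J. fps_X ^ kappa (ideals n) (plus_roots J)) = gf (Suc m) (- 1)"
  proof -
    have "(\<Sum>J | J \<in> shapes 1 n \<and> (1, n) \<in> J. fps_X ^ kappa (ideals n) (plus_roots J)) =
      (\<Sum>J | J \<in> shapes 1 (1 + Suc m) \<and> (1, 1 + Suc m) \<in> J. fps_X ^ card (corners J) :: int fps)"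
      using n by (intro sum.cong) (auto simp: kappa_plus_roots)
    then show ?thesis by (simp only: corner_gf)
  qed
  have fan: "(\<Sum>J\<in>shapes 2 (b - 1). fps_X ^ kappa (ideals n) (fan n b J)) =
      fps_X ^ (if b = n then 2 else 1) * gf (b - 2) 0" if "b \<in> {2..n}" for b
  proof -
    have "(\<Sum>J\<in>shapes 2 (b - 1). fps_X ^ kappa (ideals n) (fan n b J)) =
      fps_X ^ (if b = n then 2 else 1) * (\<Sum>J\<in>shapes 2 (b - 1). fps_X ^ card (corners J) :: int fps)"
      unfolding sum_distrib_left using that
      by (intro sum.cong refl) (simp add: kappa_fan power_add mult.commute)
    then show ?thesis using that by (simp only: fan_corner_gf atLeastAtMost_iff)
  qed
  have range: "{2..n} = insert n {2..Suc m}" using n by auto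
  have "(\<Sum>b\<in>{2..n}. \<Sum>J\<in>shapes 2 (b - 1). fps_X ^ kappa (ideals n) (fan n b J)) =
      (\<Sum>b\<in>{2..n}. fps_X ^ (if b = n then 2 else 1) * gf (b - 2) 0)"
    by (intro sum.cong refl fan)
  \<comment> \<open>The fan \<open>b = n\<close> has the extra minimal root
    \<open>eps 1 + eps n\<close>, hence the square.\<close>
  also have "\<dots> = fps_X ^ 2 * gf m 0 + (\<Sum>b\<in>{2..Suc m}. fps_X * gf (b - 2) 0)"
    unfolding range by (subst sum.insert) (auto simp: n intro!: sum.cong)
  also have "\<dots> = gf m (- 4) + gf m (- 1)"
    unfolding sum_fan_corner_gf by (simp add: power2_eq_square mult.assoc X_mult_gf)
  finally have K3: "(\<Sum>b\<in>{2..n}. \<Sum>J\<in>shapes 2 (b - 1). fps_X ^ kappa (ideals n) (fan n b J)) =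
      gf m (- 4) + gf m (- 1)" .
  have "2 \<le> n" using n by simp
  moreover have "fps_X ^ kappa (ideals n) (flip n ` I) = (fps_X ^ kappa (ideals n) I :: int fps)"
    if "I \<in> ideals n" for I
    using that by (simp add: kappa_flip)
  ultimately show ?thesis
    unfolding fps_covering_polys
    by (subst sum_ideals) (simp_all only: K0 K1 K3, simp add: algebra_simps)
qed

lemma lower_gf:
  assumes n: "n = Suc (Suc m)" and m: "1 \<le> m"
  shows "fps_of_poly (lower_covering_poly (ideals n)) =
    gf m (- 4) + gf m (- 1) + 2 * (gf m 0 + gf m (- 3)) + gf m 1 + gf m (- 2)"
proof -
  have I0: "(\<Sum>J\<in>shapes 1 (n - 1). fps_X ^ iota (ideals n) (plus_roots J)) = gf m (- 4) + gf m (- 1)"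
  proof -
    have "(\<Sum>J\<in>shapes 1 (n - 1). fps_X ^ iota (ideals n) (plus_roots J)) =
      (\<Sum>J\<in>shapes 1 (n - 1). fps_X ^ (card (gaps 1 (n - 1) J) +
         (if 1 = n - 1 \<or> (1, n - 1) \<in> J then 2 else 0)) :: int fps)"
      using n m by (intro sum.cong refl) (subst iota_plus_roots_without_tip; simp)
    also have "\<dots> = fps_X ^ 2 * gf (n - 1 - 1) 0 + fps_X ^ 0 * gf (n - 1 - 1) (- 1)"
      using n by (intro gap_gf_weighted) simp
    also have "\<dots> = gf m (- 4) + gf m (- 1)"
      by (simp add: n power2_eq_square mult.assoc X_mult_gf)
    finally show ?thesis .
  qed
  have I1: "(\<Sum>J | J \<in> shapes 1 n \<and> (1, n) \<in> J. fps_X ^ iota (ideals n) (plus_roots J)) = gf m 0 + gf m (- 3)"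
  proof -
    have "(\<Sum>J | J \<in> shapes 1 n \<and> (1, n) \<in> J. fps_X ^ iota (ideals n) (plus_roots J)) =
      (\<Sum>J | J \<in> shapes 1 n \<and> (1, n) \<in> J.
         fps_X ^ (card (gaps 1 n J) + (if (2, n) \<in> J then 0 else 1)) :: int fps)"
      using n m by (intro sum.cong refl) (subst iota_plus_roots_with_tip; simp)
    also have "\<dots> = (\<Sum>J\<in>shapes (Suc 1) n.
        fps_X ^ (card (gaps 1 n (row 1 n \<union> J)) + (if (2, n) \<in> row 1 n \<union> J then 0 else 1)))"
      using n by (intro sum_shapes_with_tip) simp
    \<comment> \<open>The alternative \<open>2 = n\<close> is false here; it gives the exponent the
      form of \<open>gap_gf_weighted\<close>.\<close>
    also have "\<dots> = (\<Sum>J\<in>shapes 2 n.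
        fps_X ^ (card (gaps 2 n J) + (if 2 = n \<or> (2, n) \<in> J then 0 else 1)))"
    proof (rule sum.cong)
      fix J assume "J \<in> shapes 2 n"
      moreover have "(2, n) \<notin> row 1 n" by (simp add: row_def)
      ultimately show "fps_X ^ (card (gaps 1 n (row 1 n \<union> J)) + (if (2, n) \<in> row 1 n \<union> J then 0 else 1)) =
        (fps_X ^ (card (gaps 2 n J) + (if 2 = n \<or> (2, n) \<in> J then 0 else 1)) :: int fps)"
        using n m gaps_row[of J 1 n] by (simp add: numeral_2_eq_2)
    qed (simp add: numeral_2_eq_2)
    also have "\<dots> = fps_X ^ 0 * gf (n - 2) 0 + fps_X ^ 1 * gf (n - 2) (- 1)"
      using n by (intro gap_gf_weighted) simp
    also have "\<dots> = gf m 0 + gf m (- 3)"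
      by (simp add: n X_mult_gf)
    finally show ?thesis .
  qed
  obtain p where p: "m = Suc p" using m by (cases m) auto
  have "(\<Sum>b\<in>{2..n}. \<Sum>J\<in>shapes 2 (b - 1). fps_X ^ iota (ideals n) (fan n b J)) =
      (\<Sum>b\<in>{2..n}. \<Sum>J\<in>shapes 2 (b - 1).
        fps_X ^ (card (gaps 2 (b - 1) J) + (if b = 2 \<or> (2, b - 1) \<in> J then 0 else 1)) :: int fps)"
    by (intro sum.cong refl) (subst iota_fan; simp)
  also have "\<dots> = gf m 1 + gf m (- 2)"
    unfolding n p sum_fan_gap_gf by (simp add: X_mult_gf)
  finally have I3: "(\<Sum>b\<in>{2..n}. \<Sum>J\<in>shapes 2 (b - 1). fps_X ^ iota (ideals n) (fan n b J)) =
      gf m 1 + gf m (- 2)" .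
  have "2 \<le> n" using n by simp
  moreover have "fps_X ^ iota (ideals n) (flip n ` I) = (fps_X ^ iota (ideals n) I :: int fps)"
    if "I \<in> ideals n" for I
    using that by (simp add: kappa_flip)
  ultimately show ?thesis
    unfolding fps_covering_polys
    by (subst sum_ideals) (simp_all only: I0 I1 I3, simp add: algebra_simps)
qed

text \<open>The equation defining the deviation has a unique polynomial solution; among power series
  the nonzero factor \<open>(fps_X - 1)^2\<close> cancels, so \<open>D\<close> must be its
  image.\<close>

lemma deviation_gf:
  assumes "finite P"
    and "fps_of_poly (upper_covering_poly P) - fps_of_poly (lower_covering_poly P) = (fps_X - 1)\<^sup>2 * D"
  shows "fps_of_poly (deviation_poly P) = D"
proof -
  have "upper_covering_poly P - lower_covering_poly P = [:-1, 1:]\<^sup>2 * deviation_poly P"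
    unfolding deviation_poly_def by (rule theI'[OF deviation_poly_ex1[OF assms(1)]])
  then have "fps_of_poly (upper_covering_poly P - lower_covering_poly P) =
      fps_of_poly ([:-1, 1:]\<^sup>2 * deviation_poly P)" by (rule arg_cong)
  moreover have "fps_of_poly [:-1, 1:] = (fps_X - 1 :: int fps)"
    by (simp add: fps_of_poly_pCons fps_eq_iff)
  ultimately have "(fps_X - 1)\<^sup>2 * fps_of_poly (deviation_poly P) = (fps_X - 1)\<^sup>2 * D"
    using assms(2) by (simp only: fps_of_poly_diff fps_of_poly_mult fps_of_poly_power)
  moreover have "(fps_X - 1 :: int fps) \<noteq> 0"
    by (metis fps_X_neq_one right_minus_eq)
  ultimately show ?thesis by simp
qed

theorem theorem5p4:
  fixes n :: nat
  assumes "n \<ge> 3"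
  shows "fps_of_poly (upper_covering_poly (abelian_ideals_D n)) =
           Abs_fps (\<lambda>k. binom (n + 2) (2 * int k) - 4 * binom (n - 1) (2 * int k - 2))
         \<and> fps_of_poly (upper_covering_poly (abelian_ideals_D n)) =
           Abs_fps (\<lambda>k. binom n (2 * int k) + binom (n - 1) (2 * int k - 1)
                      + binom (n - 2) (2 * int k - 1) + binom (n - 2) (2 * int k - 4))
         \<and> fps_of_poly (lower_covering_poly (abelian_ideals_D n)) =
           Abs_fps (\<lambda>k. binom n (2 * int k + 1) + binom n (2 * int k - 2))
         \<and> fps_of_poly (deviation_poly (abelian_ideals_D n)) =
           - Abs_fps (\<lambda>k. binom (n - 2) (2 * int k + 1) + binom (n - 3) (2 * int k))"
proof -
  \<comment> \<open>With \<open>n = p + 3\<close>, \<open>gf_Suc\<close> reduces every series below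
    to series \<open>gf p c\<close>, and each identity becomes a linear one between their
    coefficients.\<close>
  obtain p where n: "n = Suc (Suc (Suc p))"
  proof
    show "n = Suc (Suc (Suc (n - 3)))" using assms by simp
  qed
  have upper: "fps_of_poly (upper_covering_poly (abelian_ideals_D n)) =
      gf (n - 1) 0 + 2 * gf (n - 1) (- 1) + gf (n - 2) (- 1) + gf (n - 2) (- 4)"
    using upper_gf[of n "Suc p"] n upper_covering_poly_image[of "ideals n" "image vec"]
    by (simp add: abelian_ideals_D_eq ideals_image_mono)
  have lower: "fps_of_poly (lower_covering_poly (abelian_ideals_D n)) =
      gf (n - 2) (- 4) + gf (n - 2) (- 1) + 2 * (gf (n - 2) 0 + gf (n - 2) (- 3))
      + gf (n - 2) 1 + gf (n - 2) (- 2)"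
    using lower_gf[of n "Suc p"] n lower_covering_poly_image[of "ideals n" "image vec"]
    by (simp add: abelian_ideals_D_eq ideals_image_mono)
  have one: "Abs_fps (\<lambda>k. binom (n + 2) (2 * int k) - 4 * binom (n - 1) (2 * int k - 2)) =
      gf (n + 2) 0 - fps_const 4 * gf (n - 1) (- 2)"
    by (simp add: fps_eq_iff gf_def)
  have two: "Abs_fps (\<lambda>k. binom n (2 * int k) + binom (n - 1) (2 * int k - 1)
        + binom (n - 2) (2 * int k - 1) + binom (n - 2) (2 * int k - 4)) =
      gf n 0 + gf (n - 1) (- 1) + gf (n - 2) (- 1) + gf (n - 2) (- 4)"
    by (simp add: fps_eq_iff gf_def)
  have three: "Abs_fps (\<lambda>k. binom n (2 * int k + 1) + binom n (2 * int k - 2)) =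
      gf n 1 + gf n (- 2)"
    by (simp add: fps_eq_iff gf_def)
  have four: "Abs_fps (\<lambda>k. binom (n - 2) (2 * int k + 1) + binom (n - 3) (2 * int k)) =
      gf (n - 2) 1 + gf (n - 3) 0"
    by (simp add: fps_eq_iff gf_def)
  have "fps_of_poly (deviation_poly (abelian_ideals_D n)) = - (gf (n - 2) 1 + gf (n - 3) 0)"
  proof (rule deviation_gf[OF finite_abelian_ideals_D])
    let ?D = "gf (n - 2) 1 + gf (n - 3) 0"
    \<comment> \<open>Multiplication by \<open>fps_X\<close> lowers both offsets by 2, so expanding
      the square yields four shifted series besides \<open>?D\<close>.\<close>
    have X: "fps_X * ?D = gf (n - 2) (- 1) + gf (n - 3) (- 2)"
      by (simp add: distrib_left X_mult_gf)
    then have XX: "fps_X * (fps_X * ?D) = gf (n - 2) (- 3) + gf (n - 3) (- 4)"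
      by (simp add: distrib_left X_mult_gf)
    have "(fps_X - 1)\<^sup>2 * - ?D = - (gf (n - 2) (- 3) + gf (n - 3) (- 4)) +
        2 * (gf (n - 2) (- 1) + gf (n - 3) (- 2)) - ?D"
      unfolding XX[symmetric] X[symmetric] by (simp add: power2_eq_square algebra_simps)
    moreover have "\<dots> = fps_of_poly (upper_covering_poly (abelian_ideals_D n)) -
        fps_of_poly (lower_covering_poly (abelian_ideals_D n))"
      unfolding upper lower unfolding n by (intro fps_ext) (simp add: gf_Suc fps_numeral_fps_const)
    ultimately show "fps_of_poly (upper_covering_poly (abelian_ideals_D n)) -
        fps_of_poly (lower_covering_poly (abelian_ideals_D n)) = (fps_X - 1)\<^sup>2 * - ?D"
      by simp
  qed
  moreover have "fps_of_poly (upper_covering_poly (abelian_ideals_D n)) =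
      gf (n + 2) 0 - fps_const 4 * gf (n - 1) (- 2)"
    unfolding upper unfolding n by (intro fps_ext) (simp add: gf_Suc fps_numeral_fps_const)
  moreover have "fps_of_poly (upper_covering_poly (abelian_ideals_D n)) =
      gf n 0 + gf (n - 1) (- 1) + gf (n - 2) (- 1) + gf (n - 2) (- 4)"
    unfolding upper unfolding n by (intro fps_ext) (simp add: gf_Suc fps_numeral_fps_const)
  moreover have "fps_of_poly (lower_covering_poly (abelian_ideals_D n)) = gf n 1 + gf n (- 2)"
    unfolding lower unfolding n by (intro fps_ext) (simp add: gf_Suc fps_numeral_fps_const)
  ultimately show ?thesis
    unfolding one two three four by blast
qed

end
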